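(* Let $X$ be a nonempty set (finite or infinite) and let $\alpha,\beta\in P(X)$. Then $\alpha\sim_c\beta$ in $P(X)$ if and only if $\alpha=\beta=0$, or $\alpha,\beta\neq 0$ and all of the following conditions are satisfied: (1) $\mathrm{cs}(\alpha)=\mathrm{cs}(\beta)$; (2) $\alpha$ has a double ray but not a cycle if and only if $\beta$ has a double ray but not a cycle; (3a) if $\alpha$ has no cycles or double rays, then for every connected component $\gamma$ of $\alpha$ of type $rro$, $\beta$ has no cycles or double rays and has a connected component $\delta$ of type $rro$ such that $\langle\xi^\delta_n\rangle$ dominates $\langle\eta^\gamma_n\rangle$ for some maximal right rays $\eta$ in $\gamma$ and $\xi$ in $\delta$; (3b) if $\beta$ has no cycles or double rays, then for every connected component $\delta$ of $\beta$ of type $rro$, $\alpha$ has no cycles or double rays and has a connected component $\gamma$ of type $rro$ such that $\langle\eta^\gamma_n\rangle$ dominates $\langle\xi^\delta_n\rangle$ for some maximal right rays $\xi$ in $\delta$ and $\eta$ in $\gamma$; (4) $\alpha$ has a maximal left ray if and only if $\beta$ has a maximal left ray; (5a) if $\alpha$ has no maximal left rays, then for every connected component $\gamma$ of $\alpha$ of type $cho$, with root $x_0$, $\beta$ has no maximal left rays and has a connected component $\delta$ of type $cho$, with root $y_0$, such that $\rho_\gamma(x_0)\leq\rho_\delta(y_0)$; (5b) if $\beta$ has no maximal left rays, then for every connected component $\delta$ of $\beta$ of type $cho$, with root $y_0$, $\alpha$ has no maximal left rays and has a connected component $\gamma$ of type $cho$, with root $x_0$, such that $\rho_\delta(y_0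)\leq\rho_\gamma(x_0)$.
   Context: Conjugacy. For a semigroup $S$, $S^1$ is $S$ if $S$ is a monoid, and $S$ with an identity adjoined otherwise. If $S$ has a zero $0$ and $0\ne a\in S$, let $\mathbb{P}(a)=\{g\in S:(ma)g\neq 0\text{ for all }ma\in S^1a\setminus\{0\}\}$, and $\mathbb{P}(0)=\{0\}$; if $S$ has no zero, $\mathbb{P}(a)=S$ for all $a$. Put $\mathbb{P}^1(a)=\mathbb{P}(a)\cup\{1\}$. Then $a\sim_c b$ iff there are $g\in\mathbb{P}^1(a)$, $h\in\mathbb{P}^1(b)$ with $ag=gb$ and $bh=ha$. Partial transformations. $P(X)$ is the semigroup of all partial maps from $X$ to $X$, written on the right and composed left to right; its zero $0$ is the empty map. Write $x\alpha=\diamond$ (with $\diamond\notin X$) if $x\notin\mathrm{dom}(\alpha)$, and $\diamond\alpha=\diamond$. $\mathrm{span}(\alpha)=\mathrm{dom}(\alpha)\cup\mathrm{im}(\alpha)$. Basic partial transformations (all listed $x_i$ distinct; each map is defined only by the displayed arrows $x\to x\sigma$): a cycle of length $k\ge1$: $x_0\to x_1\to\cdots\to x_{k-1}\to x_0$; a right ray: $x_0\to x_1\to x_2\to\cdots$; a double ray: $\cdots\to x_{-1}\to x_0\to x_1\to\cdots$; a left ray: $\cdots\to x_2\to x_1\to x_0$; a chain of length $k\geq1$: $x_0\to x_1\to\cdots\to x_k$. A ray is a right, double, or left ray. $\beta$ is contained in $\alpha$ (also: $\alpha$ has $\beta$) if $\mathrm{dom}(\beta)\subseteq\mathrm{dom}(\alpha)$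 and $x\beta=x\alpha$ for all $x\in\mathrm{dom}(\beta)$. A basic $\mu$ contained in $\alpha$ is maximal in $\alpha$ if for every $x\in\mathrm{span}(\mu)$: $x\notin\mathrm{dom}(\mu)$ implies $x\notin\mathrm{dom}(\alpha)$, and $x\notin\mathrm{im}(\mu)$ implies $x\notin\mathrm{im}(\alpha)$. Connectedness. $\gamma\in P(X)$ is connected if $\gamma\neq0$ and for all $x,y\in\mathrm{span}(\gamma)$ there are $k,m\geq0$ with $x\gamma^k=y\gamma^m\neq\diamond$ ($\gamma^0=\mathrm{id}_X$). Every $\alpha\ne0$ is uniquely the join (union) of a set of connected transformations contained in $\alpha$ with pairwise disjoint spans; these are the connected components of $\alpha$. A connected $\gamma$ has type $rro$ if it has a maximal right ray but no cycles, double rays, left rays, or maximal chains; it has type $cho$ if it has a maximal chain but no cycles or rays. A connected $\gamma$ of type $cho$ has a unique element of $\mathrm{span}(\gamma)\setminus\mathrm{dom}(\gamma)$, called its root. Rank. If $\gamma$ is connected of type $rro$ or $cho$, the relation $\{(y,x):y\gamma=x\}$ on $\mathrm{span}(\gamma)$ is well founded; $\rho_\gamma(x)$ is the ordinal rank $\rho_\gamma(x)=\sup\{\rho_\gamma(y)+1:y\gamma=x\}$. For a maximal right ray $\eta=[x_0\,x_1\,x_2\ldots\rangle$ in $\gamma$ of type $rro$, $\eta^\gamma_n=\rho_\gamma(x_n)$ for $n\ge0$. A sequence of ordinals $\langle b_n\rangle_{n\geq0}$ dominates $\langle a_n\rangle_{n\geq0}$ if there is $k\geq0$ with $b_{k+n}\geq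 a_n$ for all $n\geq0$. Cycle set. If $\alpha$ has a cycle and $M$ is the set of lengths of cycles in $\alpha$, then $\mathrm{cs}(\alpha)$ is the set of $m\in M$ that are not multiples of any smaller element of $M$; if $\alpha$ has no cycles, $\mathrm{cs}(\alpha)=\emptyset$. *)

theory Defs
  imports Main
begin

unbundle cardinal_syntax

section \<open>Conjugacy in a semigroup\<close>

text \<open>A semigroup is given by an associative operation \<open>mul\<close> on a whole type. Elements of \<open>S\<^sup>1\<close>
  have type \<open>'s option\<close>: \<open>Some a\<close> is \<open>a \<in> S\<close>, and \<open>None\<close> is the adjoined identity, which
  belongs to \<open>S\<^sup>1\<close> only if \<open>S\<close> is not already a monoid.\<close>

definition is_zero :: "('s \<Rightarrow> 's \<Rightarrow> 's) \<Rightarrow> 's \<Rightarrow> bool" where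
  "is_zero mul z \<longleftrightarrow> (\<forall>a. mul z a = z \<and> mul a z = z)"

definition is_one :: "('s \<Rightarrow> 's \<Rightarrow> 's) \<Rightarrow> 's \<Rightarrow> bool" where
  "is_one mul e \<longleftrightarrow> (\<forall>a. mul e a = a \<and> mul a e = a)"

definition S1 :: "('s \<Rightarrow> 's \<Rightarrow> 's) \<Rightarrow> 's option set" where
  "S1 mul = (if \<exists>e. is_one mul e then range Some else UNIV)"

definition one1 :: "('s \<Rightarrow> 's \<Rightarrow> 's) \<Rightarrow> 's option" where
  "one1 mul = (if \<exists>e. is_one mul e then Some (THE e. is_one mul e) else None)"

fun mul1 :: "('s \<Rightarrow> 's \<Rightarrow> 's) \<Rightarrow> 's option \<Rightarrow> 's option \<Rightarrow> 's option" where
  "mul1 mul (Some a) (Some b) = Some (mul a b)"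
| "mul1 mul None y = y"
| "mul1 mul x None = x"

definition conjP :: "('s \<Rightarrow> 's \<Rightarrow> 's) \<Rightarrow> 's \<Rightarrow> 's set" where
  "conjP mul a =
    (if \<exists>z. is_zero mul z then
       (let z = (THE z. is_zero mul z) in
        if a = z then {z}
        else {g. \<forall>m \<in> S1 mul. mul1 mul m (Some a) \<noteq> Some z
                    \<longrightarrow> mul1 mul (mul1 mul m (Some a)) (Some g) \<noteq> Some z})
     else UNIV)"

definition conjP1 :: "('s \<Rightarrow> 's \<Rightarrow> 's) \<Rightarrow> 's \<Rightarrow> 's option set" where
  "conjP1 mul a = Some ` conjP mul a \<union> {one1 mul}"

definition conj_c :: "('s \<Rightarrow> 's \<Rightarrow> 's) \<Rightarrow> 's \<Rightarrow> 's \<Rightarrow> bool" where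
  "conj_c mul a b \<longleftrightarrow>
    (\<exists>g \<in> conjP1 mul a. \<exists>h \<in> conjP1 mul b.
       mul1 mul (Some a) g = mul1 mul g (Some b) \<and>
       mul1 mul (Some b) h = mul1 mul h (Some a))"


section \<open>The semigroup of partial transformations\<close>

text \<open>The nonempty set \<open>X\<close> is the type \<open>'a\<close>. Maps act on the right and are composed from left to
  right, so the arguments of \<^const>\<open>map_comp\<close> are swapped. The zero is \<^const>\<open>Map.empty\<close>,
  the image is \<^const>\<open>ran\<close>, the undefined value \<open>x\<alpha> = \<diamond>\<close> is \<^const>\<open>None\<close>, and ``\<open>\<beta>\<close> is contained
  in \<open>\<alpha>\<close>'' is the library's \<open>\<beta> \<subseteq>\<^sub>m \<alpha>\<close>.\<close>

definition pt_mul :: "('a \<rightharpoonup> 'a) \<Rightarrow> ('a \<rightharpoonup> 'a) \<Rightarrow> ('a \<rightharpoonup> 'a)" where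
  "pt_mul \<alpha> \<beta> = \<beta> \<circ>\<^sub>m \<alpha>"

lemma semigroup_pt_mul: "semigroup pt_mul"
  by unfold_locales (auto simp: pt_mul_def map_comp_def fun_eq_iff split: option.splits)

lemma is_zero_pt_mul: "is_zero pt_mul z \<longleftrightarrow> z = Map.empty"
proof
  assume "is_zero pt_mul z"
  then have "pt_mul z Map.empty = z" by (simp add: is_zero_def)
  then show "z = Map.empty" by (simp add: pt_mul_def map_comp_def fun_eq_iff split: option.splits)
qed (auto simp: is_zero_def pt_mul_def)

lemma is_one_pt_mul: "is_one pt_mul e \<longleftrightarrow> e = Some"
proof
  assume "is_one pt_mul e"
  then have "pt_mul e Some = Some" by (simp add: is_one_def)
  moreover have "pt_mul e Some = e" by (auto simp: pt_mul_def map_comp_def fun_eq_iff split: option.splits)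
  ultimately show "e = Some" by simp
qed (auto simp: is_one_def pt_mul_def map_comp_def fun_eq_iff split: option.splits)

primrec pt_pow :: "('a \<rightharpoonup> 'a) \<Rightarrow> nat \<Rightarrow> ('a \<rightharpoonup> 'a)" where
  "pt_pow \<alpha> 0 = Some"
| "pt_pow \<alpha> (Suc n) = pt_mul (pt_pow \<alpha> n) \<alpha>"

definition pspan :: "('a \<rightharpoonup> 'a) \<Rightarrow> 'a set" where
  "pspan \<alpha> = dom \<alpha> \<union> ran \<alpha>"


section \<open>Basic partial transformations\<close>

definition is_cycle :: "nat \<Rightarrow> ('a \<rightharpoonup> 'a) \<Rightarrow> bool" where
  "is_cycle k \<sigma> \<longleftrightarrow> k \<ge> 1 \<and>
    (\<exists>x :: nat \<Rightarrow> 'a. inj_on x {..<k} \<and> dom \<sigma> = x ` {..<k} \<and>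
       (\<forall>i<k. \<sigma> (x i) = Some (x (Suc i mod k))))"

text \<open>\<open>is_right_ray x \<sigma>\<close> means \<open>\<sigma> = [x\<^sub>0 x\<^sub>1 x\<^sub>2 \<dots>\<rangle>\<close>.\<close>
definition is_right_ray :: "(nat \<Rightarrow> 'a) \<Rightarrow> ('a \<rightharpoonup> 'a) \<Rightarrow> bool" where
  "is_right_ray x \<sigma> \<longleftrightarrow> inj x \<and> dom \<sigma> = range x \<and> (\<forall>i. \<sigma> (x i) = Some (x (Suc i)))"

definition is_double_ray :: "('a \<rightharpoonup> 'a) \<Rightarrow> bool" where
  "is_double_ray \<sigma> \<longleftrightarrow>
    (\<exists>x :: int \<Rightarrow> 'a. inj x \<and> dom \<sigma> = range x \<and> (\<forall>i. \<sigma> (x i) = Some (x (i + 1))))"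

definition is_left_ray :: "('a \<rightharpoonup> 'a) \<Rightarrow> bool" where
  "is_left_ray \<sigma> \<longleftrightarrow>
    (\<exists>x :: nat \<Rightarrow> 'a. inj x \<and> dom \<sigma> = range (\<lambda>i. x (Suc i)) \<and>
       (\<forall>i. \<sigma> (x (Suc i)) = Some (x i)))"

definition is_chain :: "nat \<Rightarrow> ('a \<rightharpoonup> 'a) \<Rightarrow> bool" where
  "is_chain k \<sigma> \<longleftrightarrow> k \<ge> 1 \<and>
    (\<exists>x :: nat \<Rightarrow> 'a. inj_on x {..k} \<and> dom \<sigma> = x ` {..<k} \<and>
       (\<forall>i<k. \<sigma> (x i) = Some (x (Suc i))))"

definition maximal_in :: "('a \<rightharpoonup> 'a) \<Rightarrow> ('a \<rightharpoonup> 'a) \<Rightarrow> bool" where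
  "maximal_in \<mu> \<alpha> \<longleftrightarrow> \<mu> \<subseteq>\<^sub>m \<alpha> \<and>
    (\<forall>x \<in> pspan \<mu>. (x \<notin> dom \<mu> \<longrightarrow> x \<notin> dom \<alpha>) \<and> (x \<notin> ran \<mu> \<longrightarrow> x \<notin> ran \<alpha>))"

definition has_cycle :: "('a \<rightharpoonup> 'a) \<Rightarrow> bool" where
  "has_cycle \<alpha> \<longleftrightarrow> (\<exists>k \<sigma>. is_cycle k \<sigma> \<and> \<sigma> \<subseteq>\<^sub>m \<alpha>)"

definition has_right_ray :: "('a \<rightharpoonup> 'a) \<Rightarrow> bool" where
  "has_right_ray \<alpha> \<longleftrightarrow> (\<exists>x \<sigma>. is_right_ray x \<sigma> \<and> \<sigma> \<subseteq>\<^sub>m \<alpha>)"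

definition has_double_ray :: "('a \<rightharpoonup> 'a) \<Rightarrow> bool" where
  "has_double_ray \<alpha> \<longleftrightarrow> (\<exists>\<sigma>. is_double_ray \<sigma> \<and> \<sigma> \<subseteq>\<^sub>m \<alpha>)"

definition has_left_ray :: "('a \<rightharpoonup> 'a) \<Rightarrow> bool" where
  "has_left_ray \<alpha> \<longleftrightarrow> (\<exists>\<sigma>. is_left_ray \<sigma> \<and> \<sigma> \<subseteq>\<^sub>m \<alpha>)"

definition has_maximal_right_ray :: "('a \<rightharpoonup> 'a) \<Rightarrow> bool" where
  "has_maximal_right_ray \<alpha> \<longleftrightarrow> (\<exists>x \<sigma>. is_right_ray x \<sigma> \<and> maximal_in \<sigma> \<alpha>)"

definition has_maximal_left_ray :: "('a \<rightharpoonup> 'a) \<Rightarrow> bool" where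
  "has_maximal_left_ray \<alpha> \<longleftrightarrow> (\<exists>\<sigma>. is_left_ray \<sigma> \<and> maximal_in \<sigma> \<alpha>)"

definition has_maximal_chain :: "('a \<rightharpoonup> 'a) \<Rightarrow> bool" where
  "has_maximal_chain \<alpha> \<longleftrightarrow> (\<exists>k \<sigma>. is_chain k \<sigma> \<and> maximal_in \<sigma> \<alpha>)"

definition cycle_lengths :: "('a \<rightharpoonup> 'a) \<Rightarrow> nat set" where
  "cycle_lengths \<alpha> = {k. \<exists>\<sigma>. is_cycle k \<sigma> \<and> \<sigma> \<subseteq>\<^sub>m \<alpha>}"

text \<open>If \<open>\<alpha>\<close> has no cycles, then \<open>cycle_lengths \<alpha>\<close>, and hence \<open>cs \<alpha>\<close>, is empty.\<close>
definition cs :: "('a \<rightharpoonup> 'a) \<Rightarrow> nat set" where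
  "cs \<alpha> = {m \<in> cycle_lengths \<alpha>. \<forall>l \<in> cycle_lengths \<alpha>. l < m \<longrightarrow> \<not> l dvd m}"


section \<open>Connected components\<close>

definition pt_connected :: "('a \<rightharpoonup> 'a) \<Rightarrow> bool" where
  "pt_connected \<gamma> \<longleftrightarrow> \<gamma> \<noteq> Map.empty \<and>
    (\<forall>x \<in> pspan \<gamma>. \<forall>y \<in> pspan \<gamma>. \<exists>k m. pt_pow \<gamma> k x = pt_pow \<gamma> m y \<and> pt_pow \<gamma> k x \<noteq> None)"

text \<open>The last conjunct says that \<open>\<alpha>\<close> is the join of \<open>C\<close>, i.e. the union as sets of pairs.\<close>
definition is_decomposition :: "('a \<rightharpoonup> 'a) set \<Rightarrow> ('a \<rightharpoonup> 'a) \<Rightarrow> bool" where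
  "is_decomposition C \<alpha> \<longleftrightarrow>
    (\<forall>\<gamma> \<in> C. pt_connected \<gamma> \<and> \<gamma> \<subseteq>\<^sub>m \<alpha>) \<and>
    (\<forall>\<gamma> \<in> C. \<forall>\<delta> \<in> C. \<gamma> \<noteq> \<delta> \<longrightarrow> pspan \<gamma> \<inter> pspan \<delta> = {}) \<and>
    Map.graph \<alpha> = (\<Union>\<gamma> \<in> C. Map.graph \<gamma>)"

text \<open>The decomposition \<open>C\<close> exists and is unique.\<close>
definition is_component :: "('a \<rightharpoonup> 'a) \<Rightarrow> ('a \<rightharpoonup> 'a) \<Rightarrow> bool" where
  "is_component \<gamma> \<alpha> \<longleftrightarrow> (\<exists>C. is_decomposition C \<alpha> \<and> \<gamma> \<in> C)"

definition type_rro :: "('a \<rightharpoonup> 'a) \<Rightarrow> bool" where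
  "type_rro \<gamma> \<longleftrightarrow> pt_connected \<gamma> \<and> has_maximal_right_ray \<gamma> \<and>
    \<not> has_cycle \<gamma> \<and> \<not> has_double_ray \<gamma> \<and> \<not> has_left_ray \<gamma> \<and> \<not> has_maximal_chain \<gamma>"

definition type_cho :: "('a \<rightharpoonup> 'a) \<Rightarrow> bool" where
  "type_cho \<gamma> \<longleftrightarrow> pt_connected \<gamma> \<and> has_maximal_chain \<gamma> \<and>
    \<not> has_cycle \<gamma> \<and> \<not> has_right_ray \<gamma> \<and> \<not> has_double_ray \<gamma> \<and> \<not> has_left_ray \<gamma>"

definition root :: "('a \<rightharpoonup> 'a) \<Rightarrow> 'a" where
  "root \<gamma> = (THE x. x \<in> pspan \<gamma> - dom \<gamma>)"


section \<open>Ordinals and rank\<close>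

text \<open>\<open>'a ordinal\<close> consists of the order types of well-orders of subsets of \<open>'a\<close>, i.e. of all
  ordinals of cardinality at most that of \<open>'a\<close>, under the usual comparison of ordinals.\<close>

quotient_type 'a ordinal = "'a rel" / partial: "\<lambda>r s. r =o s"
proof (rule part_equivpI)
  show "\<exists>r :: 'a rel. r =o r"
    using card_of_Well_order ordIso_reflexive by blast
  show "symp (\<lambda>r s :: 'a rel. r =o s)"
    by (auto intro: sympI ordIso_symmetric)
  show "transp (\<lambda>r s :: 'a rel. r =o s)"
    by (auto intro: transpI ordIso_transitive)
qed

instantiation ordinal :: (type) wellorder
begin

lift_definition less_eq_ordinal :: "'a ordinal \<Rightarrow> 'a ordinal \<Rightarrow> bool" is "\<lambda>r s. r \<le>o s"
  by (meson ordIso_ordLeq_trans ordIso_symmetric ordLeq_ordIso_trans)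

lift_definition less_ordinal :: "'a ordinal \<Rightarrow> 'a ordinal \<Rightarrow> bool" is "\<lambda>r s. r <o s"
  by (meson ordIso_ordLess_trans ordIso_symmetric ordLess_ordIso_trans)

instance
proof
  have wo: "Well_order r" if "r =o r" for r :: "'a rel"
    using that by (simp add: ordIso_def)
  fix x y z :: "'a ordinal"
  show "x < y \<longleftrightarrow> x \<le> y \<and> \<not> y \<le> x"
    by transfer (meson not_ordLess_ordLeq not_ordLeq_iff_ordLess ordLess_imp_ordLeq wo)
  show "x \<le> x"
    by transfer (use wo ordLeq_reflexive in blast)
  show "x \<le> y \<Longrightarrow> y \<le> z \<Longrightarrow> x \<le> z"
    by transfer (rule ordLeq_transitive)
  show "x \<le> y \<Longrightarrow> y \<le> x \<Longrightarrow> x = y"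
    by transfer (simp add: ordIso_iff_ordLeq)
  show "x \<le> y \<or> y \<le> x"
    by transfer (use wo ordLeq_total in blast)
next
  fix P :: "'a ordinal \<Rightarrow> bool" and a
  assume step: "\<And>x. (\<And>y. y < x \<Longrightarrow> P y) \<Longrightarrow> P x"
  have "wfP (\<lambda>x y :: 'a ordinal. x < y)"
  proof -
    have rep: "rep_ordinal x <o rep_ordinal y" if "x < y" for x y :: "'a ordinal"
      using that by (simp add: less_ordinal_def)
    have "{(x, y). x < y} \<subseteq> inv_image (ordLess :: ('a rel \<times> 'a rel) set) rep_ordinal"
      using rep by auto
    then show ?thesis
      unfolding wfp_def by (rule wf_subset[OF wf_inv_image[OF wf_ordLess]])
  qed
  then show "P a"
    by (rule wfp_induct_rule) (rule step)
qed

end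

definition ord_succ :: "'a ordinal \<Rightarrow> 'a ordinal" where
  "ord_succ a = (LEAST b. a < b)"

definition ord_sup :: "'a ordinal set \<Rightarrow> 'a ordinal" where
  "ord_sup A = (LEAST b. \<forall>a \<in> A. a \<le> b)"

text \<open>The recursion \<open>\<rho>\<^sub>\<gamma>(x) = sup {\<rho>\<^sub>\<gamma>(y) + 1 | y\<gamma> = x}\<close>, meaningful when the relation is well founded.
  The successors and suprema occurring in it then exist in \<open>'a ordinal\<close>: the ranks of the points
  of \<open>'a\<close> form an initial segment of the ordinals, with at most as many elements as \<open>'a\<close>.\<close>
definition rank :: "('a \<rightharpoonup> 'a) \<Rightarrow> 'a \<Rightarrow> 'a ordinal" where
  "rank \<gamma> = wfrec {(y, x). \<gamma> y = Some x} (\<lambda>\<rho> x. ord_sup {ord_succ (\<rho> y) | y. \<gamma> y = Some x})"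

text \<open>For \<open>\<eta> = [x\<^sub>0 x\<^sub>1 x\<^sub>2 \<dots>\<rangle>\<close>, \<open>ray_rank \<gamma> x n\<close> is \<open>\<eta>\<^sup>\<gamma>\<close> at index \<open>n\<close>.\<close>
definition ray_rank :: "('a \<rightharpoonup> 'a) \<Rightarrow> (nat \<Rightarrow> 'a) \<Rightarrow> nat \<Rightarrow> 'a ordinal" where
  "ray_rank \<gamma> x n = rank \<gamma> (x n)"

definition dominates :: "(nat \<Rightarrow> 'a ordinal) \<Rightarrow> (nat \<Rightarrow> 'a ordinal) \<Rightarrow> bool" where
  "dominates b a \<longleftrightarrow> (\<exists>k. \<forall>n. b (k + n) \<ge> a n)"

end

theory Submission
  imports Defs
begin

text \<open>View a partial map as a functional digraph. Both parts of a conjugating pair amount to maps of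
  spans that preserve edges and send points without successor to points without successor
  (\<open>pt_hom\<close> below), so \<open>\<alpha> \<sim>\<^sub>c \<beta>\<close> iff there are such homomorphisms in both directions.

  A homomorphism pushes forward cycles, bi-infinite orbits, backward sequences ending in a point
  without successor, and does not decrease ranks; this yields all the conditions. Conversely, a
  homomorphism can be built on each component separately, starting with the forward orbit of one
  point and extending it backwards along preimages. The extension never gets stuck because the
  target is a cycle, a double ray, a left ray, or a well-founded component in which the image of
  each point has at least the rank of that point.\<close>

text \<open>Membership of g in P(a), for a nonzero, is a condition on all products
  \<open>m a g\<close>; testing it with one-point maps m turns it into
  \<open>ran a \<subseteq> dom g\<close>. The commutation equation then forces g to be defined on
  the whole span of a. A homomorphism starts from a forward orbit, and this orbit has to be placed
  consistently: where it repeats, its image must repeat too. This leads to three kinds of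
  components. With a cycle of length l, the target needs a point returning after l steps, that is, a
  cycle of length dividing l; this is how \<open>cs\<close> arises. With a terminal point, the orbit
  is that single point, so only the ranks of the roots are compared. With neither, the orbit is a
  ray without repetitions and fits into any bi-infinite orbit, even one wrapped around a cycle. If
  the target has no such orbit, ranks must be compared all along the ray, because branches may join
  it arbitrarily far out. The ray may be sent to any tail of the target ray, and this freedom is the
  shift k in the definition of domination.\<close>

section \<open>Ordinals and rank\<close>

text \<open>Burali-Forti: a surjection would transport the order of all of \<open>'a ordinal\<close> to a well-order on a
  subset of \<open>'a\<close>, whose order type would exceed every element of \<open>'a ordinal\<close>.\<close>
lemma not_surj_ordinal: "\<not> surj (s :: 'a \<Rightarrow> 'a ordinal)"
proof
  assume "surj s"
  define t where "t = inv s"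
  have st[simp]: "s (t a) = a" for a
    using \<open>surj s\<close> by (simp add: t_def surj_f_inv_f)
  define r where "r S = {(u, v). u \<in> t ` S \<and> v \<in> t ` S \<and> s u \<le> s v}" for S :: "'a ordinal set"
  have Field_r: "Field (r S) = t ` S" for S
    by (auto simp: r_def Field_def)
  have WO: "Well_order (r S)" for S
  proof -
    have "wf (r S - Id)"
    proof (rule wf_subset)
      show "wf (inv_image {(x, y). x < y} s)"
        using wf by (rule wf_inv_image)
      show "r S - Id \<subseteq> inv_image {(x, y). x < y} s"
        by (auto simp: r_def)
    qed
    moreover have "Linear_order (r S)"
      unfolding Field_r
      by (auto simp: order_on_defs refl_on_def trans_def antisym_def total_on_def r_def)
    ultimately show ?thesis
      by (simp add: well_order_on_def)
  qed
  \<comment> \<open>\<open>{..<a}\<close> is a proper initial segment of any S that contains it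
    together with a, so its order type is strictly smaller.\<close>
  have mono: "abs_ordinal (r {..<a}) < abs_ordinal (r S)" if "a \<in> S" "{..<a} \<subseteq> S" for a S
  proof -
    interpret wo_rel "r S" using WO by (simp add: wo_rel_def)
    have "r {..<a} = Restr (r S) (t ` {..<a})"
      using that by (auto simp: r_def)
    moreover have "ofilter (t ` {..<a})"
      using that unfolding ofilter_def Field_r
      by (auto simp: under_def r_def)
    moreover have "t ` {..<a} \<subset> Field (r S)"
    proof -
      have "t a \<notin> t ` {..<a}" by (metis imageE lessThan_iff less_irrefl st)
      then show ?thesis using that unfolding Field_r by blast
    qed
    ultimately have "r {..<a} <o r S"
      using ofilter_ordLess[OF WO, of S "t ` {..<a}"] by simp
    then show ?thesis
      using WO by (simp add: less_ordinal.abs_eq ordIso_reflexive)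
  qed
  \<comment> \<open>A strictly increasing map of a well-order into itself lies above the identity;
    at the order type of the whole of \<open>'a ordinal\<close> this contradicts
    \<open>mono\<close>.\<close>
  have le: "a \<le> abs_ordinal (r {..<a})" for a
  proof (induction a rule: less_induct)
    case (less a)
    have "b < abs_ordinal (r {..<a})" if "b < a" for b
      using less.IH[OF that] mono[of b "{..<a}"] that by force
    then show ?case
      using leI by blast
  qed
  show False
    using le[of "abs_ordinal (r UNIV)"] mono[of "abs_ordinal (r UNIV)" UNIV] by simp
qed

section \<open>The rank as a solution of its recursion\<close>

lemma rank_unfold:
  assumes "wf {(y, x). \<gamma> y = Some x}"
  shows "rank \<gamma> x = ord_sup {ord_succ (rank \<gamma> y) | y. \<gamma> y = Some x}"
  unfolding rank_def
  by (subst wfrec[OF assms], rule arg_cong[of _ _ ord_sup]) (auto simp: cut_def)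

text \<open>The least elements in \<open>ord_succ\<close> and \<open>ord_sup\<close> exist because the ranks of the points below \<open>x\<close>
  form an initial segment, which by the previous cardinality bound is not all of \<open>'a ordinal\<close>.\<close>
lemma rank_le_iff:
  assumes wf: "wf {(y, x). \<gamma> y = Some x}"
  shows "rank \<gamma> x \<le> b \<longleftrightarrow> (\<forall>z. \<gamma> z = Some x \<longrightarrow> rank \<gamma> z < b)"
  \<comment> \<open>The transitive closure provides the induction hypothesis at all points below x,
    which the descent in \<open>below\<close> runs through.\<close>
  using wf_trancl[OF wf]
proof (induction x arbitrary: b rule: wf_induct_rule)
  case outer: (less x)
  \<comment> \<open>Descend from z: while the rank still exceeds c, the induction hypothesis
    supplies a predecessor of rank at least c. Well-foundedness stops this at a point of rank
    exactly c.\<close>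
  have below: "\<exists>w. rank \<gamma> w = c"
    if "(z, x) \<in> {(y, x). \<gamma> y = Some x}\<^sup>+" "c \<le> rank \<gamma> z" for z c
    using wf that
  proof (induction z rule: wf_induct_rule)
    case (less z)
    show ?case
    proof (cases "rank \<gamma> z \<le> c")
      case True
      then show ?thesis using less.prems(2) by (auto intro: order.antisym)
    next
      case False
      then obtain w where w: "\<gamma> w = Some z" "c \<le> rank \<gamma> w"
        using outer.IH[OF less.prems(1)] by (auto simp: not_less)
      then show ?thesis
        using less.IH[of w] less.prems(1) by (auto intro: trancl_into_trancl2)
    qed
  qed
  have "\<exists>b. \<forall>z. \<gamma> z = Some x \<longrightarrow> rank \<gamma> z < b"
  proof (rule ccontr)
    assume "\<not> ?thesis"
    then have "\<forall>b. \<exists>z. \<gamma> z = Some x \<and> b \<le> rank \<gamma> z"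
      by (auto simp: not_less)
    then have "\<forall>b. \<exists>w. rank \<gamma> w = b"
      using below by blast
    then have "surj (rank \<gamma>)"
      by (metis surjI)
    then show False
      using not_surj_ordinal by blast
  qed
  then obtain b0 where b0: "\<forall>z. \<gamma> z = Some x \<longrightarrow> rank \<gamma> z < b0" by blast
  have succ: "ord_succ (rank \<gamma> z) \<le> c \<longleftrightarrow> rank \<gamma> z < c" if "\<gamma> z = Some x" for z c
  proof -
    \<comment> \<open>The bound \<open>b0\<close> witnesses that the least element in
      \<open>ord_succ\<close> exists.\<close>
    have "rank \<gamma> z < ord_succ (rank \<gamma> z)"
      unfolding ord_succ_def by (rule LeastI[of _ b0]) (use b0 that in blast)
    moreover have "ord_succ (rank \<gamma> z) \<le> c" if "rank \<gamma> z < c"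
      unfolding ord_succ_def using that by (rule Least_le)
    ultimately show ?thesis
      by (meson less_le_trans)
  qed
  have *: "(\<forall>a \<in> {ord_succ (rank \<gamma> y) | y. \<gamma> y = Some x}. a \<le> c) \<longleftrightarrow>
      (\<forall>z. \<gamma> z = Some x \<longrightarrow> rank \<gamma> z < c)" for c
    using succ by auto
  have r: "rank \<gamma> x = (LEAST b. \<forall>z. \<gamma> z = Some x \<longrightarrow> rank \<gamma> z < b)"
    unfolding rank_unfold[OF wf, of x] ord_sup_def * ..
  have "\<forall>z. \<gamma> z = Some x \<longrightarrow> rank \<gamma> z < rank \<gamma> x"
    unfolding r using b0 by (rule LeastI)
  moreover have "rank \<gamma> x \<le> b" if "\<forall>z. \<gamma> z = Some x \<longrightarrow> rank \<gamma> z < b"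
    unfolding r using that by (rule Least_le)
  ultimately show ?case
    by (meson less_le_trans)
qed

section \<open>Powers and cycle lengths\<close>

lemma restrict_map_le: "m |` A \<subseteq>\<^sub>m m"
  by (auto simp: map_le_def restrict_map_def split: if_splits)

lemma pt_mul_apply: "pt_mul \<alpha> \<beta> x = Option.bind (\<alpha> x) \<beta>"
  by (simp add: pt_mul_def map_comp_def split: option.split)

lemma pt_pow_Suc: "pt_pow \<alpha> (Suc n) x = Option.bind (pt_pow \<alpha> n x) \<alpha>"
  by (simp add: pt_mul_apply)

declare pt_pow.simps(2) [simp del]

lemma pt_pow_add: "pt_pow \<alpha> (m + n) x = Option.bind (pt_pow \<alpha> m x) (pt_pow \<alpha> n)"
  by (induction n) (auto simp: pt_pow_Suc split: bind_splits)

lemma pt_pow_Suc2: "pt_pow \<alpha> (Suc n) x = Option.bind (\<alpha> x) (pt_pow \<alpha> n)"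
  using pt_pow_add[of \<alpha> 1 n x] by (simp add: pt_pow_Suc)

lemma pt_pow_SucD:
  assumes "pt_pow \<alpha> (Suc n) x = Some z"
  obtains y where "\<alpha> x = Some y" "pt_pow \<alpha> n y = Some z"
  using assms by (auto simp: pt_pow_Suc2 bind_eq_Some_conv)

lemma pt_pow_trans: "pt_pow \<alpha> m x = Some y \<Longrightarrow> pt_pow \<alpha> n y = z \<Longrightarrow> pt_pow \<alpha> (m + n) x = z"
  by (simp add: pt_pow_add)

lemma pt_pow_diff: "pt_pow \<alpha> m x = Some y \<Longrightarrow> m \<le> n \<Longrightarrow> pt_pow \<alpha> n x = pt_pow \<alpha> (n - m) y"
  using pt_pow_add[of \<alpha> m "n - m" x] by simp

lemma pt_pow_None_mono: "pt_pow \<alpha> m x = None \<Longrightarrow> m \<le> n \<Longrightarrow> pt_pow \<alpha> n x = None"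
  using pt_pow_add[of \<alpha> m "n - m" x] by simp

lemma pt_pow_seq:
  assumes "\<And>i. i < n \<Longrightarrow> \<alpha> (x i) = Some (x (Suc i))" "i \<le> n"
  shows "pt_pow \<alpha> i (x 0) = Some (x i)"
  using assms(2) by (induction i) (auto simp: pt_pow_Suc assms(1))

lemma pt_pow_back_seq:
  assumes "\<And>i. \<alpha> (x (Suc i)) = Some (x i)"
  shows "i \<le> j \<Longrightarrow> pt_pow \<alpha> i (x j) = Some (x (j - i))"
proof (induction i)
  case (Suc i)
  then have "j - i = Suc (j - Suc i)" by simp
  with Suc show ?case using assms[of "j - Suc i"] by (simp add: pt_pow_Suc)
qed simp

lemma pt_pow_periodic:
  assumes "pt_pow \<alpha> k x = Some x"
  shows "pt_pow \<alpha> (k * q) x = Some x"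
  by (induction q) (auto simp: pt_pow_add assms)

lemma pt_pow_total:
  assumes "pt_pow \<alpha> k x = Some x" "k \<ge> 1"
  shows "\<exists>y. pt_pow \<alpha> n x = Some y"
proof (cases "pt_pow \<alpha> n x")
  case None
  have "n \<le> k * n" using assms(2) by simp
  with None have "pt_pow \<alpha> (k * n) x = None" by (rule pt_pow_None_mono)
  then show ?thesis using pt_pow_periodic[OF assms(1), of n] by simp
qed simp

text \<open>Going on to a multiple of the period brings the point reached after i steps back to x,
  so j - i is a return time. Its remainder modulo k is one too, and minimality makes that remainder
  0.\<close>

lemma pt_pow_minimal_period:
  assumes k: "pt_pow \<alpha> k x = Some x" "k \<ge> 1" "\<And>j. 1 \<le> j \<Longrightarrow> j < k \<Longrightarrow> pt_pow \<alpha> j x \<noteq> Some x"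
    and ij: "pt_pow \<alpha> i x = pt_pow \<alpha> j x"
  shows "i mod k = j mod k"
proof -
  have "i mod k = j mod k" if "i \<le> j" "pt_pow \<alpha> i x = pt_pow \<alpha> j x" for i j
  proof -
    \<comment> \<open>With this many further steps the total is \<open>k * i\<close>; k \<ge> 1
      keeps the subtraction exact.\<close>
    let ?s = "k * i - i"
    have s: "?s + i = k * i" using k(2) by simp
    obtain y where y: "pt_pow \<alpha> i x = Some y"
      using pt_pow_total[OF k(1,2)] by blast
    have "pt_pow \<alpha> ?s y = Some x"
      using pt_pow_trans[OF y, of ?s] pt_pow_periodic[OF k(1), of i] s by (simp add: add.commute)
    moreover have "pt_pow \<alpha> ?s y = pt_pow \<alpha> (k * i + (j - i)) x"
    proof -
      have "j + ?s = k * i + (j - i)" using s that(1) by linarith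
      then show ?thesis using pt_pow_trans[of \<alpha> j x y ?s] y that(2) by simp
    qed
    ultimately have "pt_pow \<alpha> (j - i) x = Some x"
      using pt_pow_trans[OF pt_pow_periodic[OF k(1), of i], of "j - i"] by simp
    moreover have "pt_pow \<alpha> (j - i) x = pt_pow \<alpha> ((j - i) mod k) x"
      using pt_pow_trans[OF pt_pow_periodic[OF k(1), of "(j - i) div k"], of "(j - i) mod k"]
      by simp
    ultimately have "(j - i) mod k = 0"
      using k(3)[of "(j - i) mod k"] k(2) by (cases "(j - i) mod k = 0") auto
    then show ?thesis
      using that(1) mod_add_right_eq[of i "j - i" k] by simp
  qed
  then show ?thesis
    using ij nle_le by metis
qed

text \<open>Return times rather than cycle lengths: a homomorphism may wrap a cycle several times
  around a shorter one, so it preserves return times but not lengths.\<close>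

definition cycle_periods :: "('a \<rightharpoonup> 'a) \<Rightarrow> nat set" where
  "cycle_periods \<alpha> = {k. k \<ge> 1 \<and> (\<exists>x. pt_pow \<alpha> k x = Some x)}"

text \<open>Minimality of the return time is exactly what makes the k points of the orbit
  distinct.\<close>

lemma cycle_lengths_eq:
  "cycle_lengths \<alpha> =
    {k. k \<ge> 1 \<and> (\<exists>x. pt_pow \<alpha> k x = Some x \<and> (\<forall>j. 1 \<le> j \<and> j < k \<longrightarrow> pt_pow \<alpha> j x \<noteq> Some x))}"
  (is "_ = ?R")
proof (intro set_eqI iffI)
  fix k assume "k \<in> cycle_lengths \<alpha>"
  then obtain \<sigma> x where "is_cycle k \<sigma>" and \<sigma>: "\<sigma> \<subseteq>\<^sub>m \<alpha>" "inj_on x {..<k}" "dom \<sigma> = x ` {..<k}"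
      "\<forall>i<k. \<sigma> (x i) = Some (x (Suc i mod k))" and k: "k \<ge> 1"
    by (auto simp: cycle_lengths_def is_cycle_def)
  have \<alpha>: "\<alpha> (x i) = Some (x (Suc i mod k))" if "i < k" for i
    using \<sigma> that by (metis domI map_le_def)
  have pow: "pt_pow \<alpha> j (x 0) = Some (x (j mod k))" for j
  proof (induction j)
    case (Suc j)
    then show ?case using \<alpha>[of "j mod k"] k by (simp add: pt_pow_Suc mod_Suc_eq)
  qed simp
  have "pt_pow \<alpha> j (x 0) \<noteq> Some (x 0)" if "1 \<le> j" "j < k" for j
    using pow[of j] that \<sigma>(2) by (auto dest!: inj_onD[of x _ j 0])
  then show "k \<in> ?R" using pow[of k] k by auto
next
  fix k assume "k \<in> ?R"
  then obtain x where k: "pt_pow \<alpha> k x = Some x" "k \<ge> 1"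
    "\<And>j. 1 \<le> j \<Longrightarrow> j < k \<Longrightarrow> pt_pow \<alpha> j x \<noteq> Some x" by blast
  define y where "y i = the (pt_pow \<alpha> i x)" for i
  have y: "pt_pow \<alpha> i x = Some (y i)" for i
    using pt_pow_total[OF k(1,2)] unfolding y_def by (metis option.sel)
  have \<alpha>: "\<alpha> (y i) = Some (y (Suc i mod k))" if "i < k" for i
  proof -
    have "\<alpha> (y i) = Some (y (Suc i))" using y[of "Suc i"] y[of i] by (simp add: pt_pow_Suc)
    moreover have "y 0 = y k" using y[of 0] y[of k] k by simp
    ultimately show ?thesis using that by (metis Suc_lessI mod_less mod_self)
  qed
  have inj: "inj_on y {..<k}"
  proof (rule inj_onI)
    fix i j assume *: "i \<in> {..<k}" "j \<in> {..<k}" "y i = y j"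
    then have "i mod k = j mod k"
      using pt_pow_minimal_period[OF k, of i j] y by simp
    then show "i = j" using * by simp
  qed
  let ?\<sigma> = "\<alpha> |` (y ` {..<k})"
  have "is_cycle k ?\<sigma>"
    unfolding is_cycle_def using inj \<alpha> k(2) by (intro conjI exI[of _ y]) auto
  then show "k \<in> cycle_lengths \<alpha>"
    unfolding cycle_lengths_def using restrict_map_le by blast
qed

lemma cycle_periods_multiple: "k \<in> cycle_periods \<alpha> \<Longrightarrow> k dvd n \<Longrightarrow> n \<ge> 1 \<Longrightarrow> n \<in> cycle_periods \<alpha>"
  by (auto simp: cycle_periods_def dvd_def intro: pt_pow_periodic)

lemma cycle_lengths_subset: "cycle_lengths \<alpha> \<subseteq> cycle_periods \<alpha>"
  by (auto simp: cycle_lengths_eq cycle_periods_def)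

lemma cycle_periods_minimal:
  assumes "k \<ge> 1" "pt_pow \<alpha> k x = Some x"
  obtains l where "l \<ge> 1" "pt_pow \<alpha> l x = Some x"
    "\<And>j. 1 \<le> j \<Longrightarrow> j < l \<Longrightarrow> pt_pow \<alpha> j x \<noteq> Some x" "l dvd k"
proof -
  define l where "l = (LEAST l. l \<ge> 1 \<and> pt_pow \<alpha> l x = Some x)"
  have l: "l \<ge> 1 \<and> pt_pow \<alpha> l x = Some x"
    unfolding l_def by (rule LeastI[of _ k]) (use assms in simp)
  have m: "pt_pow \<alpha> j x \<noteq> Some x" if "1 \<le> j" "j < l" for j
    using not_less_Least[of j "\<lambda>l. l \<ge> 1 \<and> pt_pow \<alpha> l x = Some x"] that by (auto simp: l_def)
  have "k mod l = 0 mod l"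
    by (rule pt_pow_minimal_period[of \<alpha> l x]) (use l m assms in auto)
  then show ?thesis using that l m by auto
qed

text \<open>Every return time is divisible by the length of an actual cycle, and every length by a
  divisibility-minimal one; conversely, return times are closed under positive multiples.\<close>

lemma cycle_periods_iff: "k \<in> cycle_periods \<alpha> \<longleftrightarrow> k \<ge> 1 \<and> (\<exists>m \<in> cs \<alpha>. m dvd k)"
proof
  assume k: "k \<in> cycle_periods \<alpha>"
  then obtain x where x: "k \<ge> 1" "pt_pow \<alpha> k x = Some x" by (auto simp: cycle_periods_def)
  obtain l where l: "l \<in> cycle_lengths \<alpha>" "l dvd k"
    by (rule cycle_periods_minimal[OF x]) (auto simp: cycle_lengths_eq)
  \<comment> \<open>The least length dividing k lies in \<open>cs\<close>: a smaller length dividing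
    m would divide k as well.\<close>
  define m where "m = (LEAST m. m \<in> cycle_lengths \<alpha> \<and> m dvd k)"
  have m: "m \<in> cycle_lengths \<alpha> \<and> m dvd k"
    unfolding m_def by (rule LeastI[of _ l]) (use l in simp)
  have "\<not> l dvd m" if "l \<in> cycle_lengths \<alpha>" "l < m" for l
    using not_less_Least[of l "\<lambda>m. m \<in> cycle_lengths \<alpha> \<and> m dvd k"] that m
    by (auto simp: m_def[symmetric] dest: dvd_trans)
  then show "k \<ge> 1 \<and> (\<exists>m \<in> cs \<alpha>. m dvd k)"
    using m x by (auto simp: cs_def)
next
  assume "k \<ge> 1 \<and> (\<exists>m \<in> cs \<alpha>. m dvd k)"
  then show "k \<in> cycle_periods \<alpha>"
    using cycle_lengths_subset[of \<alpha>] cycle_periods_multiple unfolding cs_def by blast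
qed

lemma cs_eq_minimal: "cs \<alpha> = {m \<in> cycle_periods \<alpha>. \<forall>l \<in> cycle_periods \<alpha>. l dvd m \<longrightarrow> l = m}"
proof (intro set_eqI iffI)
  fix m assume m: "m \<in> cs \<alpha>"
  then have mp: "m \<in> cycle_periods \<alpha>"
    using cycle_lengths_subset by (auto simp: cs_def)
  have "l = m" if l: "l \<in> cycle_periods \<alpha>" "l dvd m" for l
  proof -
    obtain n where n: "n \<in> cs \<alpha>" "n dvd l" using l cycle_periods_iff by blast
    have "\<not> n < m" using m n l by (auto simp: cs_def dest: dvd_trans)
    moreover have "l \<le> m" "n \<le> l"
      using l n mp by (auto simp: cycle_periods_def intro!: dvd_imp_le)
    ultimately show ?thesis by simp
  qed
  then show "m \<in> {m \<in> cycle_periods \<alpha>. \<forall>l \<in> cycle_periods \<alpha>. l dvd m \<longrightarrow> l = m}"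
    using mp by blast
next
  fix m assume m: "m \<in> {m \<in> cycle_periods \<alpha>. \<forall>l \<in> cycle_periods \<alpha>. l dvd m \<longrightarrow> l = m}"
  then obtain n where n: "n \<in> cs \<alpha>" "n dvd m" using cycle_periods_iff by blast
  moreover have "n \<in> cycle_periods \<alpha>"
    using n cycle_lengths_subset by (auto simp: cs_def)
  ultimately show "m \<in> cs \<alpha>" using m by blast
qed

text \<open>\<open>cs\<close> generates the return times by taking multiples and is recovered as the
  set of their divisibility-minimal elements. Condition (1) thus becomes an equation whose two
  inclusions come from the two homomorphisms.\<close>

lemma cs_eq_iff: "cs \<alpha> = cs \<beta> \<longleftrightarrow> cycle_periods \<alpha> = cycle_periods \<beta>"
proof
  assume "cs \<alpha> = cs \<beta>"
  then show "cycle_periods \<alpha> = cycle_periods \<beta>"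
    by (intro set_eqI) (simp add: cycle_periods_iff)
qed (simp add: cs_eq_minimal)

lemma has_cycle_iff: "has_cycle \<alpha> \<longleftrightarrow> cycle_periods \<alpha> \<noteq> {}"
proof -
  have "has_cycle \<alpha> \<longleftrightarrow> cycle_lengths \<alpha> \<noteq> {}"
    by (auto simp: has_cycle_def cycle_lengths_def)
  then show ?thesis
    using cycle_lengths_subset[of \<alpha>] cycle_periods_iff[of _ \<alpha>] unfolding cs_def by blast
qed

lemma has_cycleI: "pt_pow \<alpha> k x = Some x \<Longrightarrow> k \<ge> 1 \<Longrightarrow> has_cycle \<alpha>"
  by (auto simp: has_cycle_iff cycle_periods_def)

section \<open>Connected components\<close>

text \<open>The forward orbits of x and y meet. Within the span, the classes of this relation are
  the spans of the connected components; a point off the span is related only to itself.\<close>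

definition conn :: "('a \<rightharpoonup> 'a) \<Rightarrow> 'a \<Rightarrow> 'a \<Rightarrow> bool" where
  "conn \<alpha> x y \<longleftrightarrow> (\<exists>k m z. pt_pow \<alpha> k x = Some z \<and> pt_pow \<alpha> m y = Some z)"

definition comp_of :: "('a \<rightharpoonup> 'a) \<Rightarrow> 'a \<Rightarrow> ('a \<rightharpoonup> 'a)" where
  "comp_of \<alpha> x = \<alpha> |` {y. conn \<alpha> x y}"

lemma conn_pow: "pt_pow \<alpha> n x = Some y \<Longrightarrow> conn \<alpha> x y"
  unfolding conn_def by (metis pt_pow.simps(1))

lemma conn_refl: "conn \<alpha> x x"
  by (rule conn_pow[of _ 0]) simp

lemma conn_edge: "\<alpha> x = Some y \<Longrightarrow> conn \<alpha> x y"
  by (rule conn_pow[of _ 1]) (simp add: pt_pow_Suc)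

lemma conn_sym: "conn \<alpha> x y \<Longrightarrow> conn \<alpha> y x"
  unfolding conn_def by blast

text \<open>Both meeting points lie on the forward orbit of y, so the orbit through the one reached
  first runs on to the other.\<close>

lemma conn_trans:
  assumes "conn \<alpha> x y" "conn \<alpha> y w"
  shows "conn \<alpha> x w"
proof -
  obtain k m z where 1: "pt_pow \<alpha> k x = Some z" "pt_pow \<alpha> m y = Some z"
    using assms(1) unfolding conn_def by blast
  obtain k' m' z' where 2: "pt_pow \<alpha> k' y = Some z'" "pt_pow \<alpha> m' w = Some z'"
    using assms(2) unfolding conn_def by blast
  show ?thesis
  proof (cases "m \<le> k'")
    case True
    then have "pt_pow \<alpha> (k + (k' - m)) x = Some z'"
      using 1 2 pt_pow_diff[of \<alpha> m y z k'] by (intro pt_pow_trans[OF 1(1)]) simp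
    then show ?thesis using 2 unfolding conn_def by blast
  next
    case False
    then have "pt_pow \<alpha> (m' + (m - k')) w = Some z"
      using 1 2 pt_pow_diff[of \<alpha> k' y z' m] by (intro pt_pow_trans[OF 2(2)]) simp
    then show ?thesis using 1 unfolding conn_def by blast
  qed
qed

lemma conn_edge_iff: "\<alpha> y = Some z \<Longrightarrow> conn \<alpha> x y \<longleftrightarrow> conn \<alpha> x z"
  by (meson conn_edge conn_sym conn_trans)

lemma conn_pow_iff: "pt_pow \<alpha> n y = Some z \<Longrightarrow> conn \<alpha> x y \<longleftrightarrow> conn \<alpha> x z"
  by (meson conn_pow conn_sym conn_trans)

lemma conn_class_eq: "conn \<alpha> x y \<Longrightarrow> {z. conn \<alpha> x z} = {z. conn \<alpha> y z}"
  by (meson conn_sym conn_trans Collect_cong)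

lemma comp_of_eq: "conn \<alpha> x y \<Longrightarrow> comp_of \<alpha> x = comp_of \<alpha> y"
  by (simp add: comp_of_def conn_class_eq)

text \<open>A point without successor has no forward iterate but itself, so it can only be met on
  the forward orbit of x.\<close>

lemma conn_terminal:
  assumes "conn \<alpha> x t" "\<alpha> t = None"
  obtains k where "pt_pow \<alpha> k x = Some t"
proof -
  obtain k m z where km: "pt_pow \<alpha> k x = Some z" "pt_pow \<alpha> m t = Some z"
    using assms(1) unfolding conn_def by blast
  then have "m = 0"
    using assms(2) by (cases m) (auto simp: pt_pow_Suc2)
  then show ?thesis using km that by auto
qed

lemma conn_pspan:
  assumes "conn \<alpha> x y" "x \<in> pspan \<alpha>"
  shows "y \<in> pspan \<alpha>"
proof (cases "\<alpha> y")
  case None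
  obtain k where k: "pt_pow \<alpha> k x = Some y"
    by (rule conn_terminal[OF assms(1) None])
  show ?thesis
  proof (cases k)
    case (Suc n)
    then show ?thesis using k by (auto simp: pt_pow_Suc bind_eq_Some_conv pspan_def ran_def)
  qed (use k assms in simp)
qed (auto simp: pspan_def)

lemma comp_of_Some: "comp_of \<alpha> x y = Some z \<longleftrightarrow> \<alpha> y = Some z \<and> conn \<alpha> x y"
  by (auto simp: comp_of_def restrict_map_def)

lemma comp_of_None: "conn \<alpha> x y \<Longrightarrow> comp_of \<alpha> x y = \<alpha> y"
  by (auto simp: comp_of_def)

lemma comp_of_le: "comp_of \<alpha> x \<subseteq>\<^sub>m \<alpha>"
  unfolding comp_of_def by (rule restrict_map_le)

lemma pt_pow_comp_of: "conn \<alpha> x y \<Longrightarrow> pt_pow (comp_of \<alpha> x) n y = pt_pow \<alpha> n y"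
proof (induction n)
  case (Suc n)
  have "conn \<alpha> x z" if "pt_pow \<alpha> n y = Some z" for z
    using conn_pow_iff[OF that] Suc.prems by blast
  then show ?case
    using Suc by (cases "pt_pow \<alpha> n y") (auto simp: pt_pow_Suc comp_of_None)
qed simp

lemma pspan_comp_of:
  assumes "x \<in> pspan \<alpha>"
  shows "pspan (comp_of \<alpha> x) = {y. conn \<alpha> x y}"
proof (intro set_eqI iffI)
  fix y assume "y \<in> pspan (comp_of \<alpha> x)"
  then obtain w z where "comp_of \<alpha> x y = Some z \<or> comp_of \<alpha> x w = Some y"
    by (auto simp: pspan_def ran_def)
  then show "y \<in> {y. conn \<alpha> x y}"
    using conn_edge_iff[of \<alpha> w y x] by (auto simp: comp_of_Some)
next
  fix y assume "y \<in> {y. conn \<alpha> x y}"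
  then have y: "conn \<alpha> x y" by simp
  then have "y \<in> dom \<alpha> \<or> (\<exists>w. \<alpha> w = Some y)"
    using conn_pspan[OF _ assms, of y] by (auto simp: pspan_def ran_def)
  then show "y \<in> pspan (comp_of \<alpha> x)"
  proof
    assume "y \<in> dom \<alpha>"
    then show ?thesis using y comp_of_None[OF y] by (auto simp: pspan_def)
  next
    assume "\<exists>w. \<alpha> w = Some y"
    then obtain w where "\<alpha> w = Some y" by blast
    then have "comp_of \<alpha> x w = Some y"
      using y conn_edge_iff[of \<alpha> w y x] by (simp add: comp_of_Some)
    then show ?thesis by (auto simp: pspan_def ran_def)
  qed
qed

lemma pt_connected_comp_of:
  assumes "x \<in> pspan \<alpha>"
  shows "pt_connected (comp_of \<alpha> x)"
  unfolding pt_connected_def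
proof (intro conjI ballI)
  have "x \<in> pspan (comp_of \<alpha> x)"
    by (simp add: pspan_comp_of assms conn_refl)
  then show "comp_of \<alpha> x \<noteq> Map.empty"
    by (auto simp: pspan_def)
next
  fix y z assume "y \<in> pspan (comp_of \<alpha> x)" "z \<in> pspan (comp_of \<alpha> x)"
  then have *: "conn \<alpha> x y" "conn \<alpha> x z" using pspan_comp_of[OF assms] by auto
  then have "conn \<alpha> y z" by (meson conn_sym conn_trans)
  then show "\<exists>k m. pt_pow (comp_of \<alpha> x) k y = pt_pow (comp_of \<alpha> x) m z \<and> pt_pow (comp_of \<alpha> x) k y \<noteq> None"
    using * unfolding pt_pow_comp_of[OF *(1)] pt_pow_comp_of[OF *(2)]
    by (metis conn_def option.distinct(1))
qed

lemma pt_pow_map_le: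
  assumes "\<gamma> \<subseteq>\<^sub>m \<alpha>" "pt_pow \<gamma> n x = Some y"
  shows "pt_pow \<alpha> n x = Some y"
  using assms(2)
proof (induction n arbitrary: y)
  case (Suc n)
  then obtain z where "pt_pow \<gamma> n x = Some z" "\<gamma> z = Some y"
    by (auto simp: pt_pow_Suc bind_eq_Some_conv)
  then show ?case using Suc.IH assms(1) by (auto simp: pt_pow_Suc map_le_def dom_def)
qed simp

text \<open>This contains existence and uniqueness of the decomposition: the classes of
  \<open>conn\<close> give one, and a member of any decomposition is closed under the edges of
  \<alpha> in both directions, hence fills a whole class.\<close>

lemma is_component_iff: "is_component \<gamma> \<alpha> \<longleftrightarrow> (\<exists>x \<in> pspan \<alpha>. \<gamma> = comp_of \<alpha> x)"
proof
  assume "\<exists>x \<in> pspan \<alpha>. \<gamma> = comp_of \<alpha> x"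
  then obtain x where x: "x \<in> pspan \<alpha>" "\<gamma> = comp_of \<alpha> x" by blast
  have "is_decomposition (comp_of \<alpha> ` pspan \<alpha>) \<alpha>"
    unfolding is_decomposition_def
  proof (intro conjI ballI impI)
    fix \<gamma> assume "\<gamma> \<in> comp_of \<alpha> ` pspan \<alpha>"
    then obtain y where "y \<in> pspan \<alpha>" "\<gamma> = comp_of \<alpha> y" by blast
    then show "pt_connected \<gamma>" "\<gamma> \<subseteq>\<^sub>m \<alpha>"
      by (simp_all add: pt_connected_comp_of comp_of_le)
  next
    fix \<gamma> \<delta> assume "\<gamma> \<in> comp_of \<alpha> ` pspan \<alpha>" "\<delta> \<in> comp_of \<alpha> ` pspan \<alpha>" "\<gamma> \<noteq> \<delta>"
    then obtain y z where yz: "y \<in> pspan \<alpha>" "z \<in> pspan \<alpha>" "\<gamma> = comp_of \<alpha> y" "\<delta> = comp_of \<alpha> z"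
      by blast
    then have "\<not> conn \<alpha> y z" using \<open>\<gamma> \<noteq> \<delta>\<close> comp_of_eq by metis
    then show "pspan \<gamma> \<inter> pspan \<delta> = {}"
      using yz by (auto simp: pspan_comp_of dest: conn_sym conn_trans)
  next
    show "Map.graph \<alpha> = (\<Union>\<gamma> \<in> comp_of \<alpha> ` pspan \<alpha>. Map.graph \<gamma>)"
      by (auto simp: Map.graph_def comp_of_Some pspan_def intro: conn_refl)
  qed
  then show "is_component \<gamma> \<alpha>"
    using x unfolding is_component_def by blast
next
  assume "is_component \<gamma> \<alpha>"
  then obtain C where dec: "is_decomposition C \<alpha>" and \<gamma>: "\<gamma> \<in> C"
    unfolding is_component_def by blast
  have C: "\<And>\<gamma>. \<gamma> \<in> C \<Longrightarrow> pt_connected \<gamma>" "\<And>\<gamma>. \<gamma> \<in> C \<Longrightarrow> \<gamma> \<subseteq>\<^sub>m \<alpha>"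
      "\<And>\<gamma> \<delta>. \<gamma> \<in> C \<Longrightarrow> \<delta> \<in> C \<Longrightarrow> \<gamma> \<noteq> \<delta> \<Longrightarrow> pspan \<gamma> \<inter> pspan \<delta> = {}"
      "Map.graph \<alpha> = (\<Union>\<gamma> \<in> C. Map.graph \<gamma>)"
    using dec unfolding is_decomposition_def by simp_all
  \<comment> \<open>An edge of \<alpha> lies in some member of C; if it touches the span of
    \<gamma>, disjointness of spans makes that member \<gamma> itself.\<close>
  have edge: "\<gamma> y = Some z" if yz: "\<alpha> y = Some z" and in_span: "y \<in> pspan \<gamma> \<or> z \<in> pspan \<gamma>" for y z
  proof -
    have "(y, z) \<in> Map.graph \<alpha>" using yz by (simp add: Map.graph_def)
    then obtain \<delta> where \<delta>: "\<delta> \<in> C" "\<delta> y = Some z" unfolding C(4) by (auto simp: Map.graph_def)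
    then have "y \<in> pspan \<delta>" "z \<in> pspan \<delta>" by (auto simp: pspan_def ran_def)
    then have "\<delta> = \<gamma>" using C(3)[OF \<delta>(1) \<gamma>] in_span by blast
    then show ?thesis using \<delta> by simp
  qed
  have forward: "y \<in> pspan \<gamma> \<longleftrightarrow> z \<in> pspan \<gamma>" if "pt_pow \<alpha> n y = Some z" for n y z
    using that
  proof (induction n arbitrary: y)
    case (Suc n)
    then obtain w where w: "\<alpha> y = Some w" "pt_pow \<alpha> n w = Some z"
      using pt_pow_SucD by metis
    have "y \<in> pspan \<gamma> \<longleftrightarrow> w \<in> pspan \<gamma>"
      using edge[OF w(1)] by (auto simp: pspan_def ran_def)
    then show ?case using Suc.IH[OF w(2)] by simp
  qed simp
  have "\<gamma> \<noteq> Map.empty" using C(1)[OF \<gamma>] by (simp add: pt_connected_def)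
  then obtain x where x: "x \<in> dom \<gamma>" by fastforce
  have eq: "\<gamma> y = Some z \<longleftrightarrow> comp_of \<alpha> x y = Some z" for y z
  proof
    assume yz: "\<gamma> y = Some z"
    then obtain k m where "pt_pow \<gamma> k x = pt_pow \<gamma> m y" "pt_pow \<gamma> k x \<noteq> None"
      using C(1)[OF \<gamma>] x unfolding pt_connected_def pspan_def by blast
    then have "conn \<alpha> x y"
      using pt_pow_map_le[OF C(2)[OF \<gamma>]] unfolding conn_def by (metis not_None_eq)
    then show "comp_of \<alpha> x y = Some z"
      using yz C(2)[OF \<gamma>] by (auto simp: comp_of_Some map_le_def dom_def)
  next
    assume "comp_of \<alpha> x y = Some z"
    then have "\<alpha> y = Some z" "conn \<alpha> x y" by (auto simp: comp_of_Some)
    moreover have "x \<in> pspan \<gamma>" using x by (simp add: pspan_def)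
    ultimately have "y \<in> pspan \<gamma>"
      using forward unfolding conn_def by blast
    then show "\<gamma> y = Some z" using edge \<open>\<alpha> y = Some z\<close> by blast
  qed
  have "\<gamma> = comp_of \<alpha> x"
  proof (rule ext)
    show "\<gamma> y = comp_of \<alpha> x y" for y
      by (cases "\<gamma> y"; cases "comp_of \<alpha> x y") (use eq in force)+
  qed
  moreover have "x \<in> pspan \<alpha>"
    using x C(2)[OF \<gamma>] by (auto simp: pspan_def dest: map_le_implies_dom_le)
  ultimately show "\<exists>x \<in> pspan \<alpha>. \<gamma> = comp_of \<alpha> x" by blast
qed

lemma is_componentE:
  assumes "is_component \<gamma> \<alpha>"
  obtains x where "x \<in> pspan \<alpha>" "\<gamma> = comp_of \<alpha> x"
  using assms is_component_iff[of \<gamma> \<alpha>] by auto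

lemma is_component_comp_of: "x \<in> pspan \<alpha> \<Longrightarrow> is_component (comp_of \<alpha> x) \<alpha>"
  using is_component_iff[of "comp_of \<alpha> x" \<alpha>] by auto

section \<open>Rays, chains and well-foundedness\<close>

abbreviation pred_rel :: "('a \<rightharpoonup> 'a) \<Rightarrow> 'a rel" where
  "pred_rel \<gamma> \<equiv> {(y, x). \<gamma> y = Some x}"

lemma not_wf_pred_rel_iff: "\<not> wf (pred_rel \<gamma>) \<longleftrightarrow> (\<exists>s. \<forall>i::nat. \<gamma> (s (Suc i)) = Some (s i))"
  by (simp add: wf_iff_no_infinite_down_chain)

text \<open>A repeated value would be a point returning to itself after a positive number of steps.
  The same argument serves the forward and the bi-infinite sequences below.\<close>

lemma inj_backward_seq:
  assumes s: "\<And>i::nat. \<alpha> (s (Suc i)) = Some (s i)" and "\<not> has_cycle \<alpha>"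
  shows "inj s"
proof (rule linorder_injI)
  fix i j :: nat assume "i < j"
  then have "pt_pow \<alpha> (j - i) (s j) = Some (s i)"
    using pt_pow_back_seq[of \<alpha> s "j - i" j] s by simp
  then show "s i \<noteq> s j"
    using has_cycleI[of \<alpha> "j - i" "s j"] \<open>i < j\<close> assms(2) by (auto simp: Suc_le_eq)
qed

lemma inj_forward_seq:
  assumes s: "\<And>i::nat. \<alpha> (s i) = Some (s (Suc i))" and "\<not> has_cycle \<alpha>"
  shows "inj s"
proof (rule linorder_injI)
  fix i j :: nat assume "i < j"
  then have "pt_pow \<alpha> (j - i) (s i) = Some (s j)"
    using pt_pow_seq[of "j - i" \<alpha> "\<lambda>n. s (i + n)" "j - i"] s by simp
  then show "s i \<noteq> s j"
    using has_cycleI[of \<alpha> "j - i" "s i"] \<open>i < j\<close> assms(2) by (auto simp: Suc_le_eq)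
qed

lemma inj_int_seq:
  assumes s: "\<And>i::int. \<alpha> (s i) = Some (s (i + 1))" and "\<not> has_cycle \<alpha>"
  shows "inj s"
proof (rule linorder_injI)
  fix i j :: int assume "i < j"
  then have "pt_pow \<alpha> (nat (j - i)) (s i) = Some (s j)"
    using pt_pow_seq[of "nat (j - i)" \<alpha> "\<lambda>n. s (i + int n)" "nat (j - i)"] s
    by (simp add: add.assoc add.commute[of 1])
  then show "s i \<noteq> s j"
    using has_cycleI[of \<alpha> "nat (j - i)" "s i"] \<open>i < j\<close> assms(2) by (auto simp: Suc_le_eq)
qed

text \<open>Values may repeat, so a sequence running around a cycle forever qualifies as well.
  Unlike a double ray, this notion survives every homomorphism.\<close>

definition biorbit :: "('a \<rightharpoonup> 'a) \<Rightarrow> (int \<Rightarrow> 'a) \<Rightarrow> bool" where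
  "biorbit \<alpha> y \<longleftrightarrow> (\<forall>i. \<alpha> (y i) = Some (y (i + 1)))"

lemma biorbit_iff: "(\<exists>y. biorbit \<alpha> y) \<longleftrightarrow> has_cycle \<alpha> \<or> has_double_ray \<alpha>"
proof (intro iffI)
  assume "\<exists>y. biorbit \<alpha> y"
  then obtain y where "biorbit \<alpha> y" by blast
  then have y: "\<alpha> (y i) = Some (y (i + 1))" for i by (simp add: biorbit_def)
  have "has_double_ray \<alpha>" if "\<not> has_cycle \<alpha>"
    unfolding has_double_ray_def is_double_ray_def
  proof (intro exI conjI allI)
    show "inj y" using y that by (rule inj_int_seq)
    show "dom (\<alpha> |` range y) = range y" using y by auto
    show "(\<alpha> |` range y) (y i) = Some (y (i + 1))" for i using y by simp
    show "\<alpha> |` range y \<subseteq>\<^sub>m \<alpha>" by (rule restrict_map_le)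
  qed
  then show "has_cycle \<alpha> \<or> has_double_ray \<alpha>" by blast
next
  assume "has_cycle \<alpha> \<or> has_double_ray \<alpha>"
  then show "\<exists>y. biorbit \<alpha> y"
  proof
    assume "has_cycle \<alpha>"
    then obtain k x where k: "k \<ge> 1" "pt_pow \<alpha> k x = Some x"
      by (auto simp: has_cycle_iff cycle_periods_def)
    \<comment> \<open>Run around the cycle with the index read modulo k; integer \<open>mod\<close>
      is nonnegative here, which covers negative i.\<close>
    define y where "y i = the (pt_pow \<alpha> (nat (i mod int k)) x)" for i
    have y: "pt_pow \<alpha> (nat (i mod int k)) x = Some (y i)" for i
      using pt_pow_total[OF k(2,1), of "nat (i mod int k)"] by (auto simp: y_def)
    have "\<alpha> (y i) = Some (y (i + 1))" for i
    proof -
      let ?n = "nat (i mod int k)"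
      have "\<alpha> (y i) = pt_pow \<alpha> (Suc ?n) x" using y[of i] by (simp add: pt_pow_Suc)
      also have "\<dots> = pt_pow \<alpha> (nat ((i + 1) mod int k)) x"
      \<comment> \<open>Wrapping from k - 1 to 0 is the only place where the residue does not just
        grow by one.\<close>
      proof (cases "Suc ?n = k")
        case True
        moreover have "i mod int k \<ge> 0" using k(1) by simp
        ultimately have "i mod int k + 1 = int k" by linarith
        then have "(i + 1) mod int k = 0" by (metis mod_add_left_eq mod_self)
        then show ?thesis using True k(2) by simp
      next
        case False
        have "i mod int k < int k" "i mod int k \<ge> 0" using k(1) by auto
        then have "i mod int k + 1 < int k" using False by linarith
        then have "(i + 1) mod int k = i mod int k + 1"
          using \<open>i mod int k \<ge> 0\<close> by (metis add_increasing2 mod_add_left_eq mod_pos_pos_trivial zero_le_one)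
        then show ?thesis using \<open>i mod int k \<ge> 0\<close> by (simp add: nat_add_distrib)
      qed
      finally show ?thesis using y[of "i + 1"] by simp
    qed
    then show ?thesis by (auto simp: biorbit_def)
  next
    assume "has_double_ray \<alpha>"
    then obtain \<sigma> y where "\<sigma> \<subseteq>\<^sub>m \<alpha>" "\<forall>i::int. \<sigma> (y i) = Some (y (i + 1))"
      by (auto simp: has_double_ray_def is_double_ray_def)
    then show ?thesis
      by (auto simp: biorbit_def map_le_def dom_def intro!: exI[of _ y])
  qed
qed

text \<open>Distinctness of the points comes for free, and only the end point matters for
  maximality, since every point of a left ray has a predecessor on it.\<close>

lemma has_maximal_left_ray_iff:
  "has_maximal_left_ray \<alpha> \<longleftrightarrow> (\<exists>s. (\<forall>i::nat. \<alpha> (s (Suc i)) = Some (s i)) \<and> \<alpha> (s 0) = None)"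
proof
  assume "has_maximal_left_ray \<alpha>"
  then obtain \<sigma> s where \<sigma>: "maximal_in \<sigma> \<alpha>" "inj s" "dom \<sigma> = range (\<lambda>i. s (Suc i))"
      "\<forall>i::nat. \<sigma> (s (Suc i)) = Some (s i)"
    by (auto simp: has_maximal_left_ray_def is_left_ray_def)
  have "s 0 \<notin> dom \<sigma>" using \<sigma>(2,3) by (auto dest: injD)
  moreover have "s 0 \<in> pspan \<sigma>" using \<sigma>(4) by (auto simp: pspan_def ran_def)
  ultimately have "\<alpha> (s 0) = None" using \<sigma>(1) by (auto simp: maximal_in_def)
  moreover have "\<alpha> (s (Suc i)) = Some (s i)" for i
    using \<sigma>(1,4) by (auto simp: maximal_in_def map_le_def dom_def)
  ultimately show "\<exists>s. (\<forall>i::nat. \<alpha> (s (Suc i)) = Some (s i)) \<and> \<alpha> (s 0) = None" by blast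
next
  assume "\<exists>s. (\<forall>i::nat. \<alpha> (s (Suc i)) = Some (s i)) \<and> \<alpha> (s 0) = None"
  then obtain s where s: "\<And>i. \<alpha> (s (Suc i)) = Some (s i)" "\<alpha> (s 0) = None" by blast
  have inj: "inj s"
  proof (rule linorder_injI)
    fix i j :: nat assume "i < j"
    \<comment> \<open>The forward orbit of \<open>s i\<close> leaves the domain at step i + 1, while
      that of a later \<open>s j\<close> is still defined.\<close>
    then have "pt_pow \<alpha> (Suc i) (s j) \<noteq> None" "pt_pow \<alpha> (Suc i) (s i) = None"
      using pt_pow_back_seq[of \<alpha> s "Suc i" j] pt_pow_back_seq[of \<alpha> s i i] s
      by (simp_all add: pt_pow_Suc)
    then show "s i \<noteq> s j" by metis
  qed
  let ?\<sigma> = "\<alpha> |` range (\<lambda>i. s (Suc i))"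
  have dom: "dom ?\<sigma> = range (\<lambda>i. s (Suc i))" using s by auto
  have ran: "ran ?\<sigma> = range s" using s by (auto simp: ran_def restrict_map_def)
  have "is_left_ray ?\<sigma>"
    unfolding is_left_ray_def using inj dom s by (intro exI[of _ s]) auto
  moreover have "maximal_in ?\<sigma> \<alpha>"
    unfolding maximal_in_def
  proof (intro conjI ballI impI)
    fix x assume "x \<in> pspan ?\<sigma>" "x \<notin> dom ?\<sigma>"
    then obtain i where "x = s i" "\<forall>j. i \<noteq> Suc j" unfolding pspan_def dom ran by blast
    then show "x \<notin> dom \<alpha>" using s(2) by (cases i) auto
  next
    fix x assume "x \<in> pspan ?\<sigma>" "x \<notin> ran ?\<sigma>"
    then show "x \<notin> ran \<alpha>" unfolding pspan_def dom ran by blast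
  qed (rule restrict_map_le)
  ultimately show "has_maximal_left_ray \<alpha>" unfolding has_maximal_left_ray_def by blast
qed

lemma biorbitI:
  assumes s: "\<And>i::nat. \<alpha> (s (Suc i)) = Some (s i)" and total: "\<And>n. pt_pow \<alpha> n (s 0) \<noteq> None"
  shows "\<exists>y. biorbit \<alpha> y"
proof -
  define y where "y i = (if i \<ge> 0 then the (pt_pow \<alpha> (nat i) (s 0)) else s (nat (- i)))" for i :: int
  have y: "pt_pow \<alpha> n (s 0) = Some (y (int n))" for n
    using total[of n] by (simp add: y_def)
  have "\<alpha> (y i) = Some (y (i + 1))" for i
  proof (cases "i \<ge> 0")
    case True
    then obtain n where "i = int n" using nonneg_int_cases by blast
    then show ?thesis
      using y[of n] y[of "Suc n"] by (simp add: pt_pow_Suc add.commute)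
  next
    case False
    then obtain n where n: "i = - int (Suc n)" by (metis int_cases linorder_not_le of_nat_0_le_iff)
    \<comment> \<open>For n = 0 the index i + 1 is 0 and falls into the other branch, whose value
      there is \<open>s 0\<close>.\<close>
    have "y i = s (Suc n)" "y (i + 1) = s n"
      unfolding y_def n by (cases n; simp add: nat_add_distrib)+
    then show ?thesis using s by simp
  qed
  then show ?thesis by (auto simp: biorbit_def)
qed

text \<open>The k steps from \<open>s 0\<close> to the terminal point t are prepended to the
  sequence one at a time.\<close>

lemma has_maximal_left_rayI:
  assumes s: "\<And>i::nat. \<alpha> (s (Suc i)) = Some (s i)" and t: "pt_pow \<alpha> k (s 0) = Some t" "\<alpha> t = None"
  shows "has_maximal_left_ray \<alpha>"
  using t(1) s
proof (induction k arbitrary: s)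
  case 0
  then show ?case using t(2) unfolding has_maximal_left_ray_iff by auto
next
  case (Suc k)
  obtain y where y: "\<alpha> (s 0) = Some y" "pt_pow \<alpha> k y = Some t"
    using pt_pow_SucD[OF Suc.prems(1)] .
  show ?case
    by (rule Suc.IH[of "case_nat y s"]) (use y Suc.prems(2) in \<open>auto split: nat.split\<close>)
qed

section \<open>Well-founded predecessor relations and the types rro and cho\<close>

lemma wf_no_biorbit:
  assumes "wf (pred_rel \<gamma>)"
  shows "\<not> biorbit \<gamma> y"
proof
  assume y: "biorbit \<gamma> y"
  have "\<gamma> (y (- int (Suc i))) = Some (y (- int i))" for i
    using y[unfolded biorbit_def, rule_format, of "- int (Suc i)"] by simp
  then have "\<exists>s. \<forall>i::nat. \<gamma> (s (Suc i)) = Some (s i)"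
    by (intro exI[of _ "\<lambda>i. y (- int i)"] allI)
  then show False using assms not_wf_pred_rel_iff[of \<gamma>] by blast
qed

lemma wf_no_cycle: "wf (pred_rel \<gamma>) \<Longrightarrow> \<not> has_cycle \<gamma>"
  using wf_no_biorbit biorbit_iff by blast

lemma wf_no_double_ray: "wf (pred_rel \<gamma>) \<Longrightarrow> \<not> has_double_ray \<gamma>"
  using wf_no_biorbit biorbit_iff by blast

lemma wf_no_left_ray:
  assumes "wf (pred_rel \<gamma>)"
  shows "\<not> has_left_ray \<gamma>"
proof
  assume "has_left_ray \<gamma>"
  then obtain \<sigma> s where "\<sigma> \<subseteq>\<^sub>m \<gamma>" "\<forall>i::nat. \<sigma> (s (Suc i)) = Some (s i)"
    by (auto simp: has_left_ray_def is_left_ray_def)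
  then have "\<forall>i. \<gamma> (s (Suc i)) = Some (s i)" by (auto simp: map_le_def dom_def)
  then show False using assms not_wf_pred_rel_iff[of \<gamma>] by blast
qed

text \<open>An infinite backward sequence without repetitions is a left ray, and a repetition would
  produce a cycle.\<close>

lemma wf_pred_relI:
  assumes "\<not> has_cycle \<gamma>" "\<not> has_left_ray \<gamma>"
  shows "wf (pred_rel \<gamma>)"
proof (rule ccontr)
  assume "\<not> ?thesis"
  then obtain s where s: "\<And>i::nat. \<gamma> (s (Suc i)) = Some (s i)"
    using not_wf_pred_rel_iff[of \<gamma>] by blast
  have "has_left_ray \<gamma>"
    unfolding has_left_ray_def is_left_ray_def
  proof (intro exI conjI allI)
    show "inj s" using s assms(1) by (rule inj_backward_seq)
    show "dom (\<gamma> |` range (\<lambda>i. s (Suc i))) = range (\<lambda>i. s (Suc i))" using s by auto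
    show "(\<gamma> |` range (\<lambda>i. s (Suc i))) (s (Suc i)) = Some (s i)" for i using s by simp
    show "\<gamma> |` range (\<lambda>i. s (Suc i)) \<subseteq>\<^sub>m \<gamma>" by (rule restrict_map_le)
  qed
  then show False using assms(2) by simp
qed

text \<open>This serves to lengthen rays and chains backwards until they become maximal.\<close>

lemma wf_initial_point:
  assumes "wf (pred_rel \<gamma>)"
  obtains k z where "pt_pow \<gamma> k z = Some x" "z \<notin> ran \<gamma>"
proof -
  have "\<exists>k z. pt_pow \<gamma> k z = Some x \<and> z \<notin> ran \<gamma>"
    using assms
  proof (induction x rule: wf_induct_rule)
    case (less x)
    show ?case
    proof (cases "x \<in> ran \<gamma>")
      case True
      then obtain w where "\<gamma> w = Some x" by (auto simp: ran_def)
      moreover from this obtain k z where "pt_pow \<gamma> k z = Some w" "z \<notin> ran \<gamma>"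
        using less[of w] by auto
      ultimately show ?thesis by (metis bind.bind_lunit pt_pow_Suc)
    next
      case False
      then show ?thesis by (metis pt_pow.simps(1))
    qed
  qed
  then show ?thesis using that by blast
qed

lemma ray_contained:
  assumes "is_right_ray x \<eta>" "maximal_in \<eta> \<gamma>"
  shows "\<gamma> (x i) = Some (x (Suc i))"
  using assms by (auto simp: is_right_ray_def maximal_in_def map_le_def dom_def)

text \<open>The domain of a right ray is its whole span, so maximality is decided at the starting
  point, which has no preimage here.\<close>

lemma maximal_right_ray_from:
  assumes wf: "wf (pred_rel \<gamma>)" and total: "ran \<gamma> \<subseteq> dom \<gamma>" and z: "z \<in> dom \<gamma>" "z \<notin> ran \<gamma>"
  obtains y \<eta> where "is_right_ray y \<eta>" "maximal_in \<eta> \<gamma>" "y 0 = z"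
proof -
  define y where "y i = the (pt_pow \<gamma> i z)" for i
  have pow: "\<exists>w \<in> dom \<gamma>. pt_pow \<gamma> i z = Some w" for i
  proof (induction i)
    case (Suc i)
    then obtain w v where "pt_pow \<gamma> i z = Some w" "\<gamma> w = Some v" by blast
    moreover from this have "v \<in> dom \<gamma>" using total by (auto simp: ran_def)
    ultimately show ?case by (simp add: pt_pow_Suc)
  qed (use z in simp)
  then have y_pow: "pt_pow \<gamma> i z = Some (y i)" for i
    by (metis option.sel y_def)
  have step: "\<gamma> (y i) = Some (y (Suc i))" for i
    using y_pow[of "Suc i"] y_pow[of i] by (simp add: pt_pow_Suc)
  let ?\<eta> = "\<gamma> |` range y"
  have dom: "dom ?\<eta> = range y" using step by auto
  have y0: "y 0 = z" using y_pow[of 0] by simp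
  have "is_right_ray y ?\<eta>"
    unfolding is_right_ray_def using inj_forward_seq[of \<gamma> y, OF step wf_no_cycle[OF wf]] dom step by simp
  moreover have "maximal_in ?\<eta> \<gamma>"
    unfolding maximal_in_def
  proof (intro conjI ballI impI)
    fix x assume x: "x \<in> pspan ?\<eta>"
    have "ran ?\<eta> = range (\<lambda>i. y (Suc i))" using step by (auto simp: ran_def restrict_map_def)
    moreover have "range (\<lambda>i. y (Suc i)) \<subseteq> range y" by auto
    ultimately have ran: "ran ?\<eta> = range (\<lambda>i. y (Suc i))" and xr: "x \<in> range y"
      using x dom unfolding pspan_def by auto
    show "x \<notin> dom \<gamma>" if "x \<notin> dom ?\<eta>" using that xr unfolding dom by simp
    show "x \<notin> ran \<gamma>" if "x \<notin> ran ?\<eta>"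
    proof -
      obtain i where i: "x = y i" using xr by blast
      then show ?thesis using that z(2) y0 unfolding ran by (cases i) auto
    qed
  qed (rule restrict_map_le)
  ultimately show ?thesis using y0 that by blast
qed

lemma pt_connected_conn:
  assumes "pt_connected \<gamma>" "x \<in> pspan \<gamma>" "y \<in> pspan \<gamma>"
  shows "conn \<gamma> x y"
  using assms unfolding pt_connected_def conn_def by (metis not_None_eq)

text \<open>The last point of the chain lies outside its domain, so maximality makes it terminal in
  the whole map.\<close>

lemma maximal_chain_terminal:
  assumes "has_maximal_chain \<gamma>"
  shows "\<not> ran \<gamma> \<subseteq> dom \<gamma>"
proof -
  obtain k \<sigma> x where max: "maximal_in \<sigma> \<gamma>" and k: "k \<ge> 1" and inj: "inj_on x {..k}"
    and dom: "dom \<sigma> = x ` {..<k}" and step: "\<And>i. i < k \<Longrightarrow> \<sigma> (x i) = Some (x (Suc i))"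
    using assms unfolding has_maximal_chain_def is_chain_def by blast
  have "x k \<notin> dom \<sigma>" unfolding dom using inj by (auto dest: inj_onD)
  moreover have \<sigma>: "\<sigma> (x (k - 1)) = Some (x k)" using step[of "k - 1"] k by simp
  then have "x k \<in> pspan \<sigma>" by (auto simp: pspan_def ran_def)
  ultimately have "x k \<notin> dom \<gamma>" using max unfolding maximal_in_def by blast
  moreover have "\<gamma> (x (k - 1)) = Some (x k)"
    using \<sigma> max by (auto simp: maximal_in_def map_le_def dom_def)
  then have "x k \<in> ran \<gamma>" by (rule ranI)
  ultimately show ?thesis by blast
qed

text \<open>An orbit that ended would end on the maximal right ray, which never stops. Conversely,
  going back from a point of the domain to a point without preimage and then forward forever traces
  a maximal right ray, and well-foundedness excludes the other shapes.\<close>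

lemma type_rro_iff: "type_rro \<gamma> \<longleftrightarrow> pt_connected \<gamma> \<and> wf (pred_rel \<gamma>) \<and> ran \<gamma> \<subseteq> dom \<gamma>"
proof
  assume rro: "type_rro \<gamma>"
  then have con: "pt_connected \<gamma>" by (simp add: type_rro_def)
  obtain x \<eta> where x: "is_right_ray x \<eta>" "maximal_in \<eta> \<gamma>"
    using rro by (auto simp: type_rro_def has_maximal_right_ray_def)
  have step: "\<gamma> (x i) = Some (x (Suc i))" for i by (rule ray_contained[OF x])
  have "t \<in> dom \<gamma>" if t: "t \<in> ran \<gamma>" for t
  proof (rule ccontr)
    assume nt: "t \<notin> dom \<gamma>"
    have "conn \<gamma> (x 0) t"
      using con by (rule pt_connected_conn) (use step t in \<open>auto simp: pspan_def\<close>)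
    then obtain k where "pt_pow \<gamma> k (x 0) = Some t" using nt conn_terminal by (metis domIff)
    moreover have "pt_pow \<gamma> k (x 0) = Some (x k)" by (rule pt_pow_seq[of k]) (simp_all add: step)
    ultimately show False using step[of k] nt by auto
  qed
  then show "pt_connected \<gamma> \<and> wf (pred_rel \<gamma>) \<and> ran \<gamma> \<subseteq> dom \<gamma>"
    using rro wf_pred_relI[of \<gamma>] by (auto simp: type_rro_def)
next
  assume *: "pt_connected \<gamma> \<and> wf (pred_rel \<gamma>) \<and> ran \<gamma> \<subseteq> dom \<gamma>"
  then have wf: "wf (pred_rel \<gamma>)" by simp
  have "\<gamma> \<noteq> Map.empty" using * by (simp add: pt_connected_def)
  then obtain x where x: "x \<in> dom \<gamma>" by fastforce
  obtain k z where kz: "pt_pow \<gamma> k z = Some x" "z \<notin> ran \<gamma>" by (rule wf_initial_point[OF wf])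
  then have "z \<in> dom \<gamma>" using x by (cases k) (auto simp: pt_pow_Suc2 bind_eq_Some_conv)
  then have "has_maximal_right_ray \<gamma>"
    using maximal_right_ray_from[OF wf _ _ kz(2)] * unfolding has_maximal_right_ray_def by metis
  moreover have "\<not> has_maximal_chain \<gamma>"
    using maximal_chain_terminal * by blast
  ultimately show "type_rro \<gamma>"
    using * wf_no_cycle[OF wf] wf_no_double_ray[OF wf] wf_no_left_ray[OF wf] by (simp add: type_rro_def)
qed

text \<open>The chain ends at a terminal point t and starts at a point without preimage found by
  descending from t. A right ray would have to run into t, where no further step is
  possible.\<close>

lemma type_cho_iff: "type_cho \<gamma> \<longleftrightarrow> pt_connected \<gamma> \<and> wf (pred_rel \<gamma>) \<and> \<not> ran \<gamma> \<subseteq> dom \<gamma>"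
proof
  assume cho: "type_cho \<gamma>"
  then have "\<not> ran \<gamma> \<subseteq> dom \<gamma>"
    by (simp add: type_cho_def maximal_chain_terminal)
  then show "pt_connected \<gamma> \<and> wf (pred_rel \<gamma>) \<and> \<not> ran \<gamma> \<subseteq> dom \<gamma>"
    using cho wf_pred_relI[of \<gamma>] by (auto simp: type_cho_def)
next
  assume *: "pt_connected \<gamma> \<and> wf (pred_rel \<gamma>) \<and> \<not> ran \<gamma> \<subseteq> dom \<gamma>"
  then have wf: "wf (pred_rel \<gamma>)" by simp
  obtain t where t: "t \<in> ran \<gamma>" "\<gamma> t = None" using * by auto
  obtain k z where kz: "pt_pow \<gamma> k z = Some t" "z \<notin> ran \<gamma>" by (rule wf_initial_point[OF wf])
  \<comment> \<open>The path has at least one step because t has a preimage and z has none.\<close>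
  have k: "k \<ge> 1" using kz t by (cases k) auto
  define x where "x i = the (pt_pow \<gamma> i z)" for i
  have x: "pt_pow \<gamma> i z = Some (x i)" if "i \<le> k" for i
    using pt_pow_None_mono[of \<gamma> i z k] that kz by (cases "pt_pow \<gamma> i z") (auto simp: x_def)
  have step: "\<gamma> (x i) = Some (x (Suc i))" if "i < k" for i
    using x[of i] x[of "Suc i"] that by (simp add: pt_pow_Suc)
  have ends: "x 0 = z" "x k = t" using kz by (simp_all add: x_def)
  have inj: "inj_on x {..k}"
  proof (rule linorder_inj_onI)
    fix i j assume ij: "i < j" "i \<in> {..k}" "j \<in> {..k}"
    then have "pt_pow \<gamma> (j - i) (x i) = Some (x j)"
      using pt_pow_diff[of \<gamma> i z "x i" j] x[of i] x[of j] by simp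
    then show "x i \<noteq> x j"
      using has_cycleI[of \<gamma> "j - i" "x i"] wf_no_cycle[OF wf] ij by (auto simp: Suc_le_eq)
  qed auto
  let ?\<sigma> = "\<gamma> |` (x ` {..<k})"
  have dom: "dom ?\<sigma> = x ` {..<k}" using step by auto
  have ran: "ran ?\<sigma> = (\<lambda>i. x (Suc i)) ` {..<k}" using step by (auto simp: ran_def restrict_map_def)
  have "is_chain k ?\<sigma>"
    unfolding is_chain_def using k inj dom step by (intro conjI exI[of _ x]) auto
  moreover have "maximal_in ?\<sigma> \<gamma>"
    unfolding maximal_in_def
  proof (intro conjI ballI impI)
    fix y assume "y \<in> pspan ?\<sigma>"
    then obtain i where i: "y = x i" "i \<le> k" unfolding pspan_def dom ran by force
    show "y \<notin> dom \<gamma>" if "y \<notin> dom ?\<sigma>"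
      using that i ends t unfolding dom by (cases "i = k") auto
    show "y \<notin> ran \<gamma>" if "y \<notin> ran ?\<sigma>"
      using that i ends kz unfolding ran by (cases i) auto
  qed (rule restrict_map_le)
  ultimately have "has_maximal_chain \<gamma>" unfolding has_maximal_chain_def by blast
  moreover have "\<not> has_right_ray \<gamma>"
  proof
    assume "has_right_ray \<gamma>"
    then obtain \<sigma> y where "\<sigma> \<subseteq>\<^sub>m \<gamma>" "\<forall>i. \<sigma> (y i) = Some (y (Suc i))"
      by (auto simp: has_right_ray_def is_right_ray_def)
    then have y: "\<gamma> (y i) = Some (y (Suc i))" for i
      by (auto simp: map_le_def dom_def)
    have "pt_connected \<gamma>" using * by simp
    then have "conn \<gamma> (y 0) t"
      by (rule pt_connected_conn) (use y t in \<open>auto simp: pspan_def\<close>)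
    then obtain m where "pt_pow \<gamma> m (y 0) = Some t" using t conn_terminal by metis
    moreover have "pt_pow \<gamma> m (y 0) = Some (y m)" by (rule pt_pow_seq[of m]) (simp_all add: y)
    ultimately show False using y[of m] t by auto
  qed
  ultimately show "type_cho \<gamma>"
    using * wf_no_cycle[OF wf] wf_no_double_ray[OF wf] wf_no_left_ray[OF wf] by (simp add: type_cho_def)
qed

lemma root_eq:
  assumes "pt_connected \<gamma>" "t \<in> pspan \<gamma>" "\<gamma> t = None"
  shows "root \<gamma> = t"
  unfolding root_def
proof (rule the_equality)
  fix x assume x: "x \<in> pspan \<gamma> - dom \<gamma>"
  then have "conn \<gamma> x t" using pt_connected_conn assms by fast
  then obtain k where k: "pt_pow \<gamma> k x = Some t" using conn_terminal assms(3) by metis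
  then show "x = t" using x by (cases k) (auto simp: pt_pow_Suc2 bind_eq_Some_conv)
qed (use assms in auto)

section \<open>Ranks along edges and under homomorphisms\<close>

lemma rank_less:
  assumes "wf (pred_rel \<gamma>)" "\<gamma> z = Some x"
  shows "rank \<gamma> z < rank \<gamma> x"
  using rank_le_iff[OF assms(1), of x "rank \<gamma> x"] assms(2) by simp

text \<open>At a limit rank no single predecessor accounts for the rank, but each smaller ordinal is
  matched by one. This provides the next point of a backward extension.\<close>

lemma rank_pred:
  assumes "wf (pred_rel \<gamma>)" "a < rank \<gamma> x"
  shows "\<exists>w. \<gamma> w = Some x \<and> a \<le> rank \<gamma> w"
  using rank_le_iff[OF assms(1), of x a] assms(2) by (auto simp: not_less dest: leD)

lemma rank_mono_hom:
  assumes \<gamma>: "wf (pred_rel \<gamma>)" and \<delta>: "wf (pred_rel \<delta>)"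
    and f: "\<And>x y. \<gamma> x = Some y \<Longrightarrow> \<delta> (f x) = Some (f y)"
  shows "rank \<gamma> x \<le> rank \<delta> (f x)"
  using \<gamma>
proof (induction x rule: wf_induct_rule)
  case (less x)
  have "rank \<gamma> z < rank \<delta> (f x)" if "\<gamma> z = Some x" for z
    using less[of z] rank_less[OF \<delta> f[OF that]] that by simp
  then show ?case using rank_le_iff[OF \<gamma>] by blast
qed

section \<open>Well-foundedness and types of the components of a map\<close>

lemma pt_pow_terminal:
  assumes "pt_pow \<alpha> n x = None"
  obtains k t where "pt_pow \<alpha> k x = Some t" "\<alpha> t = None"
proof -
  have "\<exists>k t. pt_pow \<alpha> k x = Some t \<and> \<alpha> t = None"
    using assms
  proof (induction n)
    case (Suc n)
    then show ?case by (cases "pt_pow \<alpha> n x") (auto simp: pt_pow_Suc)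
  qed simp
  then show ?thesis using that by blast
qed

lemma nonterminal_pow:
  assumes "\<And>t. conn \<alpha> x t \<Longrightarrow> \<alpha> t \<noteq> None" "conn \<alpha> x y"
  shows "pt_pow \<alpha> n y \<noteq> None"
proof
  assume "pt_pow \<alpha> n y = None"
  then obtain k t where "pt_pow \<alpha> k y = Some t" "\<alpha> t = None" by (rule pt_pow_terminal)
  then show False using assms conn_pow_iff by metis
qed

text \<open>An infinite backward sequence in a class without terminal points can be continued
  forward forever, which gives a bi-infinite orbit.\<close>

lemma wf_comp_of_nonterminal:
  assumes "\<And>t. conn \<alpha> x t \<Longrightarrow> \<alpha> t \<noteq> None" "\<not> (\<exists>y. biorbit \<alpha> y)"
  shows "wf (pred_rel (comp_of \<alpha> x))"
proof (rule ccontr)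
  assume "\<not> ?thesis"
  then obtain s where "\<forall>i::nat. comp_of \<alpha> x (s (Suc i)) = Some (s i)"
    using not_wf_pred_rel_iff[of "comp_of \<alpha> x"] by blast
  then have s: "\<alpha> (s (Suc i)) = Some (s i)" "conn \<alpha> x (s (Suc i))" for i
    by (simp_all add: comp_of_Some)
  then have "conn \<alpha> x (s 0)" using conn_edge_iff[of \<alpha> "s (Suc 0)" "s 0" x] s by blast
  then have "\<And>n. pt_pow \<alpha> n (s 0) \<noteq> None"
    using nonterminal_pow[of \<alpha> x] assms(1) by blast
  with s(1) have "\<exists>y. biorbit \<alpha> y" by (rule biorbitI)
  then show False using assms(2) by simp
qed

text \<open>Here an infinite backward sequence runs forward into t, and together with that path it
  forms a maximal left ray.\<close>

lemma wf_comp_of_terminal: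
  assumes "conn \<alpha> x t" "\<alpha> t = None" "\<not> has_maximal_left_ray \<alpha>"
  shows "wf (pred_rel (comp_of \<alpha> x))"
proof (rule ccontr)
  assume "\<not> ?thesis"
  then obtain s where "\<forall>i::nat. comp_of \<alpha> x (s (Suc i)) = Some (s i)"
    using not_wf_pred_rel_iff[of "comp_of \<alpha> x"] by blast
  then have s: "\<alpha> (s (Suc i)) = Some (s i)" "conn \<alpha> x (s (Suc i))" for i
    by (simp_all add: comp_of_Some)
  then have "conn \<alpha> x (s 0)" using conn_edge_iff[of \<alpha> "s (Suc 0)" "s 0" x] s by blast
  then have "conn \<alpha> (s 0) t" using assms(1) by (meson conn_sym conn_trans)
  then obtain k where "pt_pow \<alpha> k (s 0) = Some t" using conn_terminal assms(2) by metis
  then show False using has_maximal_left_rayI[of \<alpha> s] s(1) assms(2,3) by blast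
qed

lemma ran_comp_of_subset_iff:
  assumes "x \<in> pspan \<alpha>"
  shows "ran (comp_of \<alpha> x) \<subseteq> dom (comp_of \<alpha> x) \<longleftrightarrow> (\<forall>t. conn \<alpha> x t \<longrightarrow> \<alpha> t \<noteq> None)"
proof -
  have "ran (comp_of \<alpha> x) \<subseteq> dom (comp_of \<alpha> x) \<longleftrightarrow> {t. conn \<alpha> x t} \<subseteq> dom (comp_of \<alpha> x)"
    using pspan_comp_of[OF assms] by (auto simp: pspan_def)
  also have "\<dots> \<longleftrightarrow> (\<forall>t. conn \<alpha> x t \<longrightarrow> \<alpha> t \<noteq> None)"
    by (auto simp: comp_of_def)
  finally show ?thesis .
qed

lemma type_rro_comp_of:
  assumes "x \<in> pspan \<alpha>"
  shows "type_rro (comp_of \<alpha> x) \<longleftrightarrow>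
    wf (pred_rel (comp_of \<alpha> x)) \<and> (\<forall>t. conn \<alpha> x t \<longrightarrow> \<alpha> t \<noteq> None)"
  by (simp only: type_rro_iff pt_connected_comp_of[OF assms] ran_comp_of_subset_iff[OF assms] simp_thms)

lemma type_cho_comp_of:
  assumes "x \<in> pspan \<alpha>"
  shows "type_cho (comp_of \<alpha> x) \<longleftrightarrow>
    wf (pred_rel (comp_of \<alpha> x)) \<and> (\<exists>t. conn \<alpha> x t \<and> \<alpha> t = None)"
  unfolding type_cho_iff ran_comp_of_subset_iff[OF assms] using pt_connected_comp_of[OF assms] by simp

lemma root_comp_of:
  assumes "x \<in> pspan \<alpha>" "conn \<alpha> x t" "\<alpha> t = None"
  shows "root (comp_of \<alpha> x) = t"
  by (rule root_eq) (use assms in \<open>simp_all add: pt_connected_comp_of pspan_comp_of comp_of_None\<close>)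

section \<open>Conjugacy through homomorphisms\<close>

text \<open>The equation at \<open>None\<close> is the condition on terminal points. Values of f off
  the span are arbitrary, so a total function can stand for a partial one.\<close>

definition pt_hom :: "('a \<Rightarrow> 'a) \<Rightarrow> ('a \<rightharpoonup> 'a) \<Rightarrow> ('a \<rightharpoonup> 'a) \<Rightarrow> bool" where
  "pt_hom f \<alpha> \<beta> \<longleftrightarrow> (\<forall>x \<in> pspan \<alpha>. \<beta> (f x) = map_option f (\<alpha> x))"

lemma one1_pt_mul: "one1 pt_mul = Some Some"
proof -
  have "is_one pt_mul = (\<lambda>e :: 'a \<rightharpoonup> 'a. e = Some)"
    by (simp add: fun_eq_iff is_one_pt_mul)
  then show ?thesis by (simp add: one1_def)
qed

lemma S1_pt_mul: "S1 pt_mul = range Some"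
  by (simp add: S1_def is_one_pt_mul)

text \<open>A nonzero product of m and a takes a value in \<open>ran a\<close>, and one-point maps m
  single out each such value.\<close>

lemma conjP_pt_mul: "conjP pt_mul a = (if a = Map.empty then {Map.empty} else {g. ran a \<subseteq> dom g})"
proof -
  have zero: "is_zero pt_mul = (\<lambda>z :: 'a \<rightharpoonup> 'a. z = Map.empty)"
    by (simp add: fun_eq_iff is_zero_pt_mul)
  show ?thesis
  proof (cases "a = Map.empty")
    case False
    have "(\<forall>m. pt_mul m a \<noteq> Map.empty \<longrightarrow> pt_mul (pt_mul m a) g \<noteq> Map.empty) \<longleftrightarrow> ran a \<subseteq> dom g" for g
    proof
      assume *: "\<forall>m. pt_mul m a \<noteq> Map.empty \<longrightarrow> pt_mul (pt_mul m a) g \<noteq> Map.empty"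
      show "ran a \<subseteq> dom g"
      proof
        fix v assume "v \<in> ran a"
        then obtain w where w: "a w = Some v" by (auto simp: ran_def)
        \<comment> \<open>Left multiplication by the identity on {w} cuts a down to the single arrow
          from w to v.\<close>
        have m: "pt_mul [w \<mapsto> w] a = [w \<mapsto> v]" by (auto simp: pt_mul_apply w fun_eq_iff)
        then have "pt_mul [w \<mapsto> v] g \<noteq> Map.empty" using * by (metis fun_upd_same option.distinct(1))
        then show "v \<in> dom g" by (auto simp: pt_mul_apply fun_eq_iff split: if_splits)
      qed
    next
      assume *: "ran a \<subseteq> dom g"
      show "\<forall>m. pt_mul m a \<noteq> Map.empty \<longrightarrow> pt_mul (pt_mul m a) g \<noteq> Map.empty"
      proof (intro allI impI)
        fix m assume "pt_mul m a \<noteq> Map.empty"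
        then obtain u v where u: "pt_mul m a u = Some v" by (metis ext not_None_eq)
        then have "v \<in> ran a" by (auto simp: pt_mul_apply ran_def bind_eq_Some_conv)
        then have "pt_mul (pt_mul m a) g u \<noteq> None" using * u by (auto simp: pt_mul_apply[of "pt_mul m a"])
        then show "pt_mul (pt_mul m a) g \<noteq> Map.empty" by metis
      qed
    qed
    then show ?thesis using False
      by (simp add: conjP_def zero S1_pt_mul)
  qed (simp add: conjP_def zero)
qed

lemma conjP1_pt_mul:
  "conjP1 pt_mul a = Some ` (if a = Map.empty then {Map.empty, Some} else {g. ran a \<subseteq> dom g})"
  by (auto simp: conjP1_def conjP_pt_mul one1_pt_mul)

text \<open>The inclusion defines g on the image of \<alpha> only. At a point x with successor y the
  equation does the rest: g is defined at y, so both products are defined at x, and hence g is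
  defined at x.\<close>

lemma pt_hom_iff:
  "(\<exists>g. ran \<alpha> \<subseteq> dom g \<and> pt_mul \<alpha> g = pt_mul g \<beta>) \<longleftrightarrow> (\<exists>f. pt_hom f \<alpha> \<beta>)"
proof
  assume "\<exists>g. ran \<alpha> \<subseteq> dom g \<and> pt_mul \<alpha> g = pt_mul g \<beta>"
  then obtain g where g: "ran \<alpha> \<subseteq> dom g" "pt_mul \<alpha> g = pt_mul g \<beta>" by blast
  define f where "f x = the (g x)" for x
  have eq: "Option.bind (\<alpha> x) g = Option.bind (g x) \<beta>" for x
    using fun_cong[OF g(2), of x] by (simp add: pt_mul_apply)
  have r: "g x = Some (f x)" if "x \<in> ran \<alpha>" for x
    using that g(1) by (auto simp: f_def)
  have s: "g x = Some (f x)" if "x \<in> pspan \<alpha>" for x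
  proof (cases "\<alpha> x")
    case (Some y)
    then have "g y = Some (f y)" using r by (auto simp: ran_def)
    then show ?thesis using eq[of x] Some by (cases "g x") (auto simp: f_def)
  next
    case None
    then show ?thesis using r that by (auto simp: pspan_def)
  qed
  have "\<beta> (f x) = map_option f (\<alpha> x)" if "x \<in> pspan \<alpha>" for x
    using eq[of x] s[OF that] r[OF ranI, of x] by (cases "\<alpha> x") auto
  then show "\<exists>f. pt_hom f \<alpha> \<beta>" by (auto simp: pt_hom_def)
next
  assume "\<exists>f. pt_hom f \<alpha> \<beta>"
  then obtain f where f: "\<And>x. x \<in> pspan \<alpha> \<Longrightarrow> \<beta> (f x) = map_option f (\<alpha> x)" by (auto simp: pt_hom_def)
  \<comment> \<open>Cutting f down to the span leaves both products undefined elsewhere.\<close>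
  define g where "g = (Some \<circ> f) |` pspan \<alpha>"
  have "pt_mul \<alpha> g x = pt_mul g \<beta> x" for x
  proof (cases "x \<in> pspan \<alpha>")
    case True
    then show ?thesis
      using f[OF True] by (cases "\<alpha> x") (auto simp: pt_mul_apply g_def pspan_def ran_def restrict_map_def)
  next
    case False
    then have "\<alpha> x = None" "g x = None" by (auto simp: pspan_def g_def)
    then show ?thesis by (simp add: pt_mul_apply)
  qed
  moreover have "ran \<alpha> \<subseteq> dom g" by (auto simp: g_def pspan_def)
  ultimately show "\<exists>g. ran \<alpha> \<subseteq> dom g \<and> pt_mul \<alpha> g = pt_mul g \<beta>" by blast
qed

text \<open>The requirements on g and h do not interact, so the existential quantifiers split. If
  exactly one map is empty, the direction out of the other one fails, because an edge has no image
  in the empty map.\<close>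

lemma conj_c_pt_mul_iff:
  "conj_c pt_mul \<alpha> \<beta> \<longleftrightarrow> (\<alpha> = Map.empty \<and> \<beta> = Map.empty) \<or>
    (\<alpha> \<noteq> Map.empty \<and> \<beta> \<noteq> Map.empty \<and> (\<exists>f. pt_hom f \<alpha> \<beta>) \<and> (\<exists>f. pt_hom f \<beta> \<alpha>))"
proof -
  have side: "(\<exists>g \<in> conjP1 pt_mul a. mul1 pt_mul (Some a) g = mul1 pt_mul g (Some b)) \<longleftrightarrow>
      (\<exists>f. pt_hom f a b)" if "a \<noteq> Map.empty" for a b
    using that pt_hom_iff[of a b] by (auto simp: conjP1_pt_mul)
  have split: "conj_c pt_mul \<alpha> \<beta> \<longleftrightarrow>
      (\<exists>g \<in> conjP1 pt_mul \<alpha>. mul1 pt_mul (Some \<alpha>) g = mul1 pt_mul g (Some \<beta>)) \<and>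
      (\<exists>h \<in> conjP1 pt_mul \<beta>. mul1 pt_mul (Some \<beta>) h = mul1 pt_mul h (Some \<alpha>))"
    unfolding conj_c_def by blast
  have no_hom: "\<not> pt_hom f a Map.empty" if "a \<noteq> Map.empty" for a and f
  proof
    assume f: "pt_hom f a Map.empty"
    have "dom a \<noteq> {}" using that by simp
    then obtain x y where "a x = Some y" by blast
    moreover from this have "x \<in> pspan a" by (auto simp: pspan_def)
    ultimately show False using f unfolding pt_hom_def by (metis option.distinct(1) option.simps(9))
  qed
  show ?thesis
  proof (cases "\<alpha> = Map.empty \<or> \<beta> = Map.empty")
    case True
    have "conj_c pt_mul \<alpha> \<beta>" if "\<alpha> = Map.empty" "\<beta> = Map.empty"
      unfolding split using that by (auto simp: conjP1_pt_mul)
    moreover have "\<beta> = Map.empty" if "\<alpha> = Map.empty" "conj_c pt_mul \<alpha> \<beta>"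
      using that side[of \<beta> \<alpha>] no_hom[of \<beta>] unfolding split by blast
    moreover have "\<alpha> = Map.empty" if "\<beta> = Map.empty" "conj_c pt_mul \<alpha> \<beta>"
      using that side[of \<alpha> \<beta>] no_hom[of \<alpha>] unfolding split by blast
    ultimately show ?thesis using True by blast
  next
    case False
    then show ?thesis using side[of \<alpha> \<beta>] side[of \<beta> \<alpha>] unfolding split by simp
  qed
qed

section \<open>Extending homomorphisms backwards\<close>

text \<open>\<open>R z w\<close> reads ``\<open>z\<close> may be mapped to \<open>w\<close>''; the last assumption lets a map be continued to
  preimages.\<close>
lemma extend_hom:
  assumes base: "\<And>i. rel_option R (pt_pow \<alpha> i x\<^sub>0) (pt_pow \<beta> i y\<^sub>0)"
    and cong: "\<And>i j x. pt_pow \<alpha> i x\<^sub>0 = Some x \<Longrightarrow> pt_pow \<alpha> j x\<^sub>0 = Some x \<Longrightarrow>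
      pt_pow \<beta> i y\<^sub>0 = pt_pow \<beta> j y\<^sub>0"
    and step: "\<And>x y z. R x y \<Longrightarrow> \<alpha> z = Some x \<Longrightarrow> \<exists>w. \<beta> w = Some y \<and> R z w"
  shows "\<exists>f. \<forall>x. conn \<alpha> x\<^sub>0 x \<longrightarrow> \<beta> (f x) = map_option f (\<alpha> x)"
proof -
  define A where "A = {x. \<exists>i. pt_pow \<alpha> i x\<^sub>0 = Some x}"
  \<comment> \<open>By \<open>cong\<close>, every index at which the orbit passes x gives the same
    value; taking the least is a mere choice.\<close>
  define f\<^sub>0 where "f\<^sub>0 x = the (pt_pow \<beta> (LEAST i. pt_pow \<alpha> i x\<^sub>0 = Some x) y\<^sub>0)" for x
  have f\<^sub>0: "pt_pow \<beta> i y\<^sub>0 = Some (f\<^sub>0 x)" if i: "pt_pow \<alpha> i x\<^sub>0 = Some x" for i x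
  proof -
    let ?l = "LEAST i. pt_pow \<alpha> i x\<^sub>0 = Some x"
    have "pt_pow \<alpha> ?l x\<^sub>0 = Some x" using i by (rule LeastI)
    then have "pt_pow \<beta> i y\<^sub>0 = pt_pow \<beta> ?l y\<^sub>0" using i cong by blast
    moreover have "pt_pow \<beta> i y\<^sub>0 \<noteq> None" using base[of i] i by (cases "pt_pow \<beta> i y\<^sub>0") simp_all
    ultimately show ?thesis by (simp add: f\<^sub>0_def)
  qed
  \<comment> \<open>Off the orbit, images are chosen by recursion on the number of steps needed to
    reach it, so that the successor of a point has its image before the point itself.\<close>
  define d where "d x = (LEAST n. \<exists>y \<in> A. pt_pow \<alpha> n x = Some y)" for x
  define G where "G = rec_nat f\<^sub>0 (\<lambda>n g x. SOME w. \<beta> w = Some (g (the (\<alpha> x))) \<and> R x w)"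
  define f where "f x = G (d x) x" for x
  have fA: "f x = f\<^sub>0 x" if "x \<in> A" for x
  proof -
    have "d x = 0" unfolding d_def by (rule Least_eq_0) (use that in simp)
    then show ?thesis by (simp add: f_def G_def)
  qed
  have A: "R x (f x) \<and> \<beta> (f x) = map_option f (\<alpha> x)" if x: "x \<in> A" for x
  proof -
    obtain i where i: "pt_pow \<alpha> i x\<^sub>0 = Some x" using x unfolding A_def by blast
    have "R x (f x)" using base[of i] i f\<^sub>0[OF i] fA[OF x] by simp
    moreover have "\<beta> (f x) = map_option f (\<alpha> x)"
    proof (cases "\<alpha> x")
      case None
      \<comment> \<open>\<open>base\<close> also says that the two forward orbits end at the same
        step.\<close>
      then have "pt_pow \<beta> (Suc i) y\<^sub>0 = None" using base[of "Suc i"] i by (simp add: pt_pow_Suc)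
      then show ?thesis using None f\<^sub>0[OF i] fA[OF x] by (simp add: pt_pow_Suc)
    next
      case (Some y)
      then have y: "pt_pow \<alpha> (Suc i) x\<^sub>0 = Some y" using i by (simp add: pt_pow_Suc)
      then have "y \<in> A" unfolding A_def by blast
      then show ?thesis
        using Some f\<^sub>0[OF i] f\<^sub>0[OF y] fA x by (simp add: pt_pow_Suc)
    qed
    ultimately show ?thesis ..
  qed
  have main: "R x (f x) \<and> \<beta> (f x) = map_option f (\<alpha> x)" if "\<exists>y \<in> A. pt_pow \<alpha> n x = Some y" for n x
    using that
  proof (induction n arbitrary: x)
    case 0
    then show ?case using A by simp
  next
    case (Suc n)
    show ?case
    proof (cases "x \<in> A")
      case True
      then show ?thesis by (rule A)
    next
      case False
      obtain y x' where y: "y \<in> A" "\<alpha> x = Some x'" "pt_pow \<alpha> n x' = Some y"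
        using Suc.prems pt_pow_SucD by metis
      then have IH: "R x' (f x')" using Suc.IH by blast
      \<comment> \<open>Since x is off the orbit, the first step of its path can be split off, and
        the distance of x is one more than that of x'.\<close>
      have "d x = Suc (LEAST m. \<exists>y \<in> A. pt_pow \<alpha> (Suc m) x = Some y)"
        unfolding d_def by (rule Least_Suc[where n = "Suc n"]) (use Suc.prems False in simp_all)
      also have "\<dots> = Suc (d x')" using y(2) by (simp add: d_def pt_pow_Suc2)
      finally have "f x = (SOME w. \<beta> w = Some (f x') \<and> R x w)"
        using y(2) by (simp add: f_def G_def)
      then have "\<beta> (f x) = Some (f x') \<and> R x (f x)"
        using someI_ex[OF step[OF IH y(2)]] by simp
      then show ?thesis using y(2) by simp
    qed
  qed
  have "\<beta> (f x) = map_option f (\<alpha> x)" if "conn \<alpha> x\<^sub>0 x" for x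
    using main that unfolding conn_def A_def by blast
  then show ?thesis by blast
qed

text \<open>The choice is indexed by the class as a set, so connected points use the same
  map.\<close>

lemma glue_hom:
  assumes "\<And>x. x \<in> pspan \<alpha> \<Longrightarrow> \<exists>f. \<forall>y. conn \<alpha> x y \<longrightarrow> \<beta> (f y) = map_option f (\<alpha> y)"
  shows "\<exists>f. pt_hom f \<alpha> \<beta>"
proof -
  have "\<exists>f. \<forall>y \<in> K. \<beta> (f y) = map_option f (\<alpha> y)" if "K \<in> (\<lambda>x. {y. conn \<alpha> x y}) ` pspan \<alpha>" for K
    using assms that by fast
  then obtain F where F: "\<And>K y. K \<in> (\<lambda>x. {y. conn \<alpha> x y}) ` pspan \<alpha> \<Longrightarrow> y \<in> K \<Longrightarrow>
      \<beta> (F K y) = map_option (F K) (\<alpha> y)"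
    by metis
  define f where "f x = F {y. conn \<alpha> x y} x" for x
  have "\<beta> (f x) = map_option f (\<alpha> x)" if "x \<in> pspan \<alpha>" for x
  proof -
    have "f y = F {y. conn \<alpha> x y} y" if "\<alpha> x = Some y" for y
      using conn_class_eq[OF conn_edge[of \<alpha> x y]] that by (simp add: f_def)
    then have "map_option (F {y. conn \<alpha> x y}) (\<alpha> x) = map_option f (\<alpha> x)"
      by (cases "\<alpha> x") auto
    moreover have "\<beta> (f x) = map_option (F {y. conn \<alpha> x y}) (\<alpha> x)"
      unfolding f_def by (rule F) (use that conn_refl in auto)
    ultimately show ?thesis by simp
  qed
  then show ?thesis by (auto simp: pt_hom_def)
qed

section \<open>Mapping a single component\<close>

lemma pt_pow_mod: "pt_pow \<alpha> k x = Some x \<Longrightarrow> pt_pow \<alpha> (n mod k) x = pt_pow \<alpha> n x"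
  using pt_pow_trans[OF pt_pow_periodic[of \<alpha> k x "n div k"], of "n mod k"] by simp

text \<open>As k is the least return time of c, the orbit of c repeats only modulo k, and there the
  orbit of w repeats as well, even if w returns earlier.\<close>

lemma hom_to_cycle:
  assumes c: "pt_pow \<alpha> k c = Some c" "k \<ge> 1" "\<And>j. 1 \<le> j \<Longrightarrow> j < k \<Longrightarrow> pt_pow \<alpha> j c \<noteq> Some c"
    and w: "pt_pow \<beta> k w = Some w"
  shows "\<exists>f. \<forall>x. conn \<alpha> c x \<longrightarrow> \<beta> (f x) = map_option f (\<alpha> x)"
proof (rule extend_hom[where R = "\<lambda>x y. \<exists>i. pt_pow \<beta> i w = Some y"])
  fix i
  obtain u v where "pt_pow \<alpha> i c = Some u" "pt_pow \<beta> i w = Some v"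
    using pt_pow_total[OF c(1,2)] pt_pow_total[OF w c(2)] by blast
  then show "rel_option (\<lambda>x y. \<exists>i. pt_pow \<beta> i w = Some y) (pt_pow \<alpha> i c) (pt_pow \<beta> i w)"
    by auto
next
  fix i j x assume "pt_pow \<alpha> i c = Some x" "pt_pow \<alpha> j c = Some x"
  then have "i mod k = j mod k" using pt_pow_minimal_period[OF c, of i j] by simp
  then show "pt_pow \<beta> i w = pt_pow \<beta> j w" using pt_pow_mod[OF w] by metis
next
  fix y assume "\<exists>i. pt_pow \<beta> i w = Some y"
  then obtain i where "pt_pow \<beta> i w = Some y" by blast
  \<comment> \<open>Going once more around the cycle and stopping one step short gives a preimage of
    y even when i = 0.\<close>
  then have "pt_pow \<beta> (Suc (k + i - 1)) w = Some y"
    using pt_pow_trans[OF w, of i] c(2) by simp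
  then show "\<exists>v. \<beta> v = Some y \<and> (\<exists>i. pt_pow \<beta> i w = Some v)"
    by (auto simp: pt_pow_Suc bind_eq_Some_conv)
qed

text \<open>Without a cycle the forward orbit of x never repeats, so it can be laid along y even if
  y runs around a cycle.\<close>

lemma hom_to_biorbit:
  assumes acyclic: "\<And>y k. conn \<alpha> x y \<Longrightarrow> k \<ge> 1 \<Longrightarrow> pt_pow \<alpha> k y \<noteq> Some y"
    and total: "\<And>t. conn \<alpha> x t \<Longrightarrow> \<alpha> t \<noteq> None" and y: "biorbit \<beta> y"
  shows "\<exists>f. \<forall>z. conn \<alpha> x z \<longrightarrow> \<beta> (f z) = map_option f (\<alpha> z)"
proof (rule extend_hom[where R = "\<lambda>z w. w \<in> range y"])
  fix i
  have "pt_pow \<alpha> i x \<noteq> None"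
    using total conn_refl by (rule nonterminal_pow)
  then obtain u where "pt_pow \<alpha> i x = Some u" by blast
  moreover have "pt_pow \<beta> i (y 0) = Some (y (int i))"
    using y pt_pow_seq[of i \<beta> "\<lambda>n. y (int n)" i] by (simp add: biorbit_def add.commute)
  ultimately show "rel_option (\<lambda>z w. w \<in> range y) (pt_pow \<alpha> i x) (pt_pow \<beta> i (y 0))"
    by simp
next
  fix i j z assume ij: "pt_pow \<alpha> i x = Some z" "pt_pow \<alpha> j x = Some z"
  have "\<not> i < j" if "pt_pow \<alpha> i x = Some z" "pt_pow \<alpha> j x = Some z" for i j
  proof
    assume "i < j"
    then have "pt_pow \<alpha> (j - i) z = Some z" using pt_pow_diff[OF that(1), of j] that(2) by simp
    then show False using acyclic[OF conn_pow[OF that(1)], of "j - i"] \<open>i < j\<close> by simp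
  qed
  then have "i = j" using ij by (metis linorder_neqE_nat)
  then show "pt_pow \<beta> i (y 0) = pt_pow \<beta> j (y 0)" by simp
next
  fix w assume "w \<in> range y"
  then obtain i where "w = y i" by blast
  then show "\<exists>v. \<beta> v = Some w \<and> v \<in> range y"
    using y[unfolded biorbit_def, rule_format, of "i - 1"] by auto
qed

text \<open>The forward orbit of a terminal base point is that point alone, so consistency is
  trivial and only the backward step remains.\<close>

lemma extend_hom_terminal:
  assumes "\<alpha> t = None" "\<beta> u = None" "R t u"
    and "\<And>x y z. R x y \<Longrightarrow> \<alpha> z = Some x \<Longrightarrow> \<exists>w. \<beta> w = Some y \<and> R z w"
  shows "\<exists>f. \<forall>x. conn \<alpha> t x \<longrightarrow> \<beta> (f x) = map_option f (\<alpha> x)"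
proof (rule extend_hom[where R = R])
  show "rel_option R (pt_pow \<alpha> i t) (pt_pow \<beta> i u)" for i
    using assms(1-3) by (cases i) (simp_all add: pt_pow_Suc2)
  show "pt_pow \<beta> i u = pt_pow \<beta> j u" if "pt_pow \<alpha> i t = Some x" "pt_pow \<alpha> j t = Some x" for i j x
    using that assms(1) by (cases i; cases j) (simp_all add: pt_pow_Suc2)
qed (fact assms(4))

lemma hom_to_left_ray:
  assumes "\<alpha> t = None" "has_maximal_left_ray \<beta>"
  shows "\<exists>f. \<forall>x. conn \<alpha> t x \<longrightarrow> \<beta> (f x) = map_option f (\<alpha> x)"
proof -
  obtain s where s: "\<And>i::nat. \<beta> (s (Suc i)) = Some (s i)" "\<beta> (s 0) = None"
    using assms(2) unfolding has_maximal_left_ray_iff by blast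
  show ?thesis
    by (rule extend_hom_terminal[of _ _ _ "s 0" "\<lambda>x w. w \<in> range s"]) (use assms(1) s in auto)
qed

text \<open>The rank of z is strictly below that of x, hence below that of y, so y has a preimage of
  at least the rank of z. Membership in the components is carried along because the ranks are taken
  inside them.\<close>

lemma rank_lift:
  assumes wf: "wf (pred_rel (comp_of \<alpha> a))" "wf (pred_rel (comp_of \<beta> b))"
    and xy: "conn \<alpha> a x" "conn \<beta> b y" "rank (comp_of \<alpha> a) x \<le> rank (comp_of \<beta> b) y"
    and z: "\<alpha> z = Some x"
  shows "\<exists>w. \<beta> w = Some y \<and> conn \<alpha> a z \<and> conn \<beta> b w \<and> rank (comp_of \<alpha> a) z \<le> rank (comp_of \<beta> b) w"
proof -
  have az: "conn \<alpha> a z" using conn_edge_iff[of \<alpha> z x a] z xy(1) by simp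
  then have "comp_of \<alpha> a z = Some x" using z by (simp add: comp_of_Some)
  then have "rank (comp_of \<alpha> a) z < rank (comp_of \<beta> b) y"
    using rank_less[OF wf(1)] xy(3) by (meson less_le_trans)
  then show ?thesis
    using rank_pred[OF wf(2)] az by (metis comp_of_Some)
qed

lemma hom_by_root_rank:
  assumes wf: "wf (pred_rel (comp_of \<alpha> t))" "wf (pred_rel (comp_of \<beta> u))"
    and tu: "\<alpha> t = None" "\<beta> u = None" "rank (comp_of \<alpha> t) t \<le> rank (comp_of \<beta> u) u"
  shows "\<exists>f. \<forall>x. conn \<alpha> t x \<longrightarrow> \<beta> (f x) = map_option f (\<alpha> x)"
proof (rule extend_hom_terminal[of _ _ _ u
      "\<lambda>x y. conn \<alpha> t x \<and> conn \<beta> u y \<and> rank (comp_of \<alpha> t) x \<le> rank (comp_of \<beta> u) y"])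
  show "conn \<alpha> t t \<and> conn \<beta> u u \<and> rank (comp_of \<alpha> t) t \<le> rank (comp_of \<beta> u) u"
    using tu(3) by (simp add: conn_refl)
next
  fix x y z
  assume "conn \<alpha> t x \<and> conn \<beta> u y \<and> rank (comp_of \<alpha> t) x \<le> rank (comp_of \<beta> u) y" "\<alpha> z = Some x"
  then show "\<exists>w. \<beta> w = Some y \<and> conn \<alpha> t z \<and> conn \<beta> u w \<and>
      rank (comp_of \<alpha> t) z \<le> rank (comp_of \<beta> u) w"
    using rank_lift[OF wf] by blast
qed (fact tu)+

lemma hom_by_ray_rank:
  assumes wf: "wf (pred_rel (comp_of \<alpha> a))" "wf (pred_rel (comp_of \<beta> b))"
    and x: "\<And>i. comp_of \<alpha> a (x i) = Some (x (Suc i))"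
    and y: "\<And>i. comp_of \<beta> b (y i) = Some (y (Suc i))"
    and dom: "dominates (ray_rank (comp_of \<beta> b) y) (ray_rank (comp_of \<alpha> a) x)"
  shows "\<exists>f. \<forall>z. conn \<alpha> a z \<longrightarrow> \<beta> (f z) = map_option f (\<alpha> z)"
proof -
  obtain k where k: "\<And>n. rank (comp_of \<alpha> a) (x n) \<le> rank (comp_of \<beta> b) (y (k + n))"
    using dom by (auto simp: dominates_def ray_rank_def)
  let ?R = "\<lambda>x y. conn \<alpha> a x \<and> conn \<beta> b y \<and> rank (comp_of \<alpha> a) x \<le> rank (comp_of \<beta> b) y"
  have inj: "inj x" using x wf_no_cycle[OF wf(1)] by (rule inj_forward_seq)
  have x': "\<alpha> (x i) = Some (x (Suc i))" "conn \<alpha> a (x i)" for i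
    using x[of i] by (simp_all add: comp_of_Some)
  have y': "\<beta> (y i) = Some (y (Suc i))" "conn \<beta> b (y i)" for i
    using y[of i] by (simp_all add: comp_of_Some)
  have xp: "pt_pow \<alpha> i (x 0) = Some (x i)" for i
    by (rule pt_pow_seq[of i]) (simp_all add: x')
  have yp: "pt_pow \<beta> i (y k) = Some (y (k + i))" for i
    using pt_pow_seq[of i \<beta> "\<lambda>n. y (k + n)" i] by (simp add: y')
  have "\<exists>f. \<forall>z. conn \<alpha> (x 0) z \<longrightarrow> \<beta> (f z) = map_option f (\<alpha> z)"
  proof (rule extend_hom[where R = ?R and y\<^sub>0 = "y k"])
    show "rel_option ?R (pt_pow \<alpha> i (x 0)) (pt_pow \<beta> i (y k))" for i
      using k[of i] x' y' by (simp add: xp yp)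
    show "pt_pow \<beta> i (y k) = pt_pow \<beta> j (y k)"
      if "pt_pow \<alpha> i (x 0) = Some z" "pt_pow \<alpha> j (x 0) = Some z" for i j z
    proof -
      have "x i = x j" using that by (simp add: xp)
      then show ?thesis using inj by (simp add: inj_eq)
    qed
    show "\<exists>w. \<beta> w = Some v \<and> ?R z w" if "?R u v" "\<alpha> z = Some u" for u v z
      using that rank_lift[OF wf] by blast
  qed
  moreover have "conn \<alpha> (x 0) z" if "conn \<alpha> a z" for z
    using that x'(2)[of 0] by (meson conn_sym conn_trans)
  ultimately show ?thesis by blast
qed

section \<open>Homomorphisms and the conjugacy invariants\<close>

lemma hom_pow:
  assumes f: "pt_hom f \<alpha> \<beta>" and n: "pt_pow \<alpha> n x = Some y"
  shows "pt_pow \<beta> n (f x) = Some (f y)"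
  using n
proof (induction n arbitrary: y)
  case (Suc n)
  then obtain z where z: "pt_pow \<alpha> n x = Some z" "\<alpha> z = Some y"
    by (auto simp: pt_pow_Suc bind_eq_Some_conv)
  then have "z \<in> pspan \<alpha>" by (auto simp: pspan_def)
  then have "\<beta> (f z) = Some (f y)" using f z(2) by (simp add: pt_hom_def)
  then show ?case using Suc.IH[OF z(1)] by (simp add: pt_pow_Suc)
qed simp

lemma hom_edge: "pt_hom f \<alpha> \<beta> \<Longrightarrow> \<alpha> x = Some y \<Longrightarrow> \<beta> (f x) = Some (f y)"
  using hom_pow[of f \<alpha> \<beta> 1 x y] by (simp add: pt_pow_Suc)

lemma hom_terminal: "pt_hom f \<alpha> \<beta> \<Longrightarrow> x \<in> pspan \<alpha> \<Longrightarrow> \<alpha> x = None \<Longrightarrow> \<beta> (f x) = None"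
  by (simp add: pt_hom_def)

lemma hom_conn: "pt_hom f \<alpha> \<beta> \<Longrightarrow> conn \<alpha> x y \<Longrightarrow> conn \<beta> (f x) (f y)"
  unfolding conn_def by (meson hom_pow)

lemma hom_pspan:
  assumes "pt_hom f \<alpha> \<beta>" "x \<in> pspan \<alpha>"
  shows "f x \<in> pspan \<beta>"
proof -
  obtain y where "\<alpha> x = Some y \<or> \<alpha> y = Some x"
    using assms(2) by (auto simp: pspan_def ran_def)
  then show ?thesis
    using hom_edge[OF assms(1)] by (fastforce simp: pspan_def ran_def)
qed

text \<open>If the orbit of \<open>f x\<close> ended after k steps, the image of k + 1 steps from x
  would contradict this.\<close>

lemma hom_nonterminal:
  assumes f: "pt_hom f \<alpha> \<beta>" and total: "\<And>t. conn \<alpha> x t \<Longrightarrow> \<alpha> t \<noteq> None" and t: "conn \<beta> (f x) t"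
  shows "\<beta> t \<noteq> None"
proof
  assume nt: "\<beta> t = None"
  obtain k where k: "pt_pow \<beta> k (f x) = Some t" by (rule conn_terminal[OF t nt])
  have "pt_pow \<alpha> (Suc k) x \<noteq> None"
    using total conn_refl by (rule nonterminal_pow)
  then obtain z where "pt_pow \<alpha> (Suc k) x = Some z" by blast
  from hom_pow[OF f this] show False using k nt by (simp add: pt_pow_Suc)
qed

lemma hom_comp_of:
  assumes "pt_hom f \<alpha> \<beta>" "comp_of \<alpha> x y = Some z"
  shows "comp_of \<beta> (f x) (f y) = Some (f z)"
  using assms hom_edge hom_conn by (metis comp_of_Some)

lemma hom_cycle_periods: "pt_hom f \<alpha> \<beta> \<Longrightarrow> cycle_periods \<alpha> \<subseteq> cycle_periods \<beta>"
  by (auto simp: cycle_periods_def dest: hom_pow)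

lemma hom_biorbit: "pt_hom f \<alpha> \<beta> \<Longrightarrow> biorbit \<alpha> y \<Longrightarrow> biorbit \<beta> (f \<circ> y)"
  by (simp add: biorbit_def hom_edge)

lemma hom_maximal_left_ray:
  assumes "pt_hom f \<alpha> \<beta>" "has_maximal_left_ray \<alpha>"
  shows "has_maximal_left_ray \<beta>"
proof -
  obtain s where s: "\<And>i::nat. \<alpha> (s (Suc i)) = Some (s i)" "\<alpha> (s 0) = None"
    using assms(2) unfolding has_maximal_left_ray_iff by blast
  have "s 0 \<in> pspan \<alpha>" using s(1)[of 0] by (auto simp: pspan_def ran_def)
  then have "\<beta> (f (s 0)) = None" using hom_terminal[OF assms(1)] s(2) by blast
  moreover have "\<beta> (f (s (Suc i))) = Some (f (s i))" for i
    using hom_edge[OF assms(1)] s(1) by blast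
  ultimately show ?thesis
    unfolding has_maximal_left_ray_iff by (intro exI[of _ "\<lambda>i. f (s i)"]) simp
qed

text \<open>The image of a maximal right ray need not be maximal. It is lengthened backwards to a
  point z without preimage, and the length k of the added path is the shift in the
  domination.\<close>

lemma hom_rro:
  assumes f: "pt_hom f \<alpha> \<beta>" and no: "\<not> (\<exists>y. biorbit \<beta> y)"
    and \<gamma>: "is_component \<gamma> \<alpha>" "type_rro \<gamma>"
  shows "\<exists>\<delta>. is_component \<delta> \<beta> \<and> type_rro \<delta> \<and>
    (\<exists>\<eta> x \<xi> y. is_right_ray x \<eta> \<and> maximal_in \<eta> \<gamma> \<and> is_right_ray y \<xi> \<and> maximal_in \<xi> \<delta> \<and>
      dominates (ray_rank \<delta> y) (ray_rank \<gamma> x))"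
proof -
  obtain a where a: "a \<in> pspan \<alpha>" "\<gamma> = comp_of \<alpha> a" by (rule is_componentE[OF \<gamma>(1)])
  have wf: "wf (pred_rel \<gamma>)" and total: "\<And>t. conn \<alpha> a t \<Longrightarrow> \<alpha> t \<noteq> None"
    using \<gamma>(2) type_rro_comp_of[OF a(1)] unfolding a(2) by blast+
  define \<delta> where "\<delta> = comp_of \<beta> (f a)"
  have fa: "f a \<in> pspan \<beta>" using hom_pspan[OF f a(1)] .
  have total': "\<And>t. conn \<beta> (f a) t \<Longrightarrow> \<beta> t \<noteq> None"
    using hom_nonterminal[OF f] total by blast
  have wf': "wf (pred_rel \<delta>)"
    unfolding \<delta>_def using total' no by (rule wf_comp_of_nonterminal)
  have comp: "is_component \<delta> \<beta>" unfolding \<delta>_def using fa by (rule is_component_comp_of)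
  have rro: "type_rro \<delta>" unfolding \<delta>_def
    using type_rro_comp_of[OF fa] wf' total' unfolding \<delta>_def by blast
  obtain x \<eta> where x: "is_right_ray x \<eta>" "maximal_in \<eta> \<gamma>"
    using \<gamma>(2) unfolding type_rro_def has_maximal_right_ray_def by blast
  have xs: "\<gamma> (x i) = Some (x (Suc i))" for i by (rule ray_contained[OF x])
  have fe: "\<delta> (f u) = Some (f v)" if "\<gamma> u = Some v" for u v
    using hom_comp_of[OF f] that unfolding a(2) \<delta>_def by blast
  obtain k z where z: "pt_pow \<delta> k z = Some (f (x 0))" "z \<notin> ran \<delta>" by (rule wf_initial_point[OF wf'])
  \<comment> \<open>For k = 0 the point z is \<open>f (x 0)\<close> itself, which has a successor on
    the image ray.\<close>
  have "z \<in> dom \<delta>" using z(1) fe[OF xs[of 0]] by (cases k) (auto simp: pt_pow_Suc2 bind_eq_Some_conv)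
  moreover have "ran \<delta> \<subseteq> dom \<delta>" using rro type_rro_iff[of \<delta>] by simp
  ultimately obtain y \<xi> where y: "is_right_ray y \<xi>" "maximal_in \<xi> \<delta>" "y 0 = z"
    using maximal_right_ray_from[OF wf' _ _ z(2)] by metis
  have "pt_pow \<delta> n (y 0) = Some (y n)" for n
    by (rule pt_pow_seq[of n]) (simp_all add: ray_contained[OF y(1,2)])
  moreover have "pt_pow \<delta> (k + n) z = Some (f (x n))" for n
  proof (induction n)
    case (Suc n)
    then show ?case using fe[OF xs] by (simp add: pt_pow_Suc)
  qed (use z in simp)
  ultimately have "y (k + n) = f (x n)" for n using y(3) by (metis option.inject)
  then have "dominates (ray_rank \<delta> y) (ray_rank \<gamma> x)"
    unfolding dominates_def ray_rank_def using rank_mono_hom[of \<gamma> \<delta> f] wf wf' fe by metis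
  then show ?thesis using comp rro x y by blast
qed

text \<open>A terminal point is sent to a terminal point, so the root goes to the root, and ranks do
  not decrease.\<close>

lemma hom_cho:
  assumes f: "pt_hom f \<alpha> \<beta>" and no: "\<not> has_maximal_left_ray \<beta>"
    and \<gamma>: "is_component \<gamma> \<alpha>" "type_cho \<gamma>"
  shows "\<exists>\<delta>. is_component \<delta> \<beta> \<and> type_cho \<delta> \<and> rank \<gamma> (root \<gamma>) \<le> rank \<delta> (root \<delta>)"
proof -
  obtain a where a: "a \<in> pspan \<alpha>" "\<gamma> = comp_of \<alpha> a" by (rule is_componentE[OF \<gamma>(1)])
  obtain t where wf: "wf (pred_rel \<gamma>)" and t: "conn \<alpha> a t" "\<alpha> t = None"
    using \<gamma>(2) type_cho_comp_of[OF a(1)] unfolding a(2) by blast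
  define \<delta> where "\<delta> = comp_of \<beta> (f a)"
  have fa: "f a \<in> pspan \<beta>" using hom_pspan[OF f a(1)] .
  have ft: "conn \<beta> (f a) (f t)" "\<beta> (f t) = None"
    using hom_conn[OF f t(1)] hom_terminal[OF f conn_pspan[OF t(1) a(1)] t(2)] by auto
  have wf': "wf (pred_rel \<delta>)" unfolding \<delta>_def using ft no by (rule wf_comp_of_terminal)
  have "type_cho \<delta>" using type_cho_comp_of[OF fa] ft wf' unfolding \<delta>_def by blast
  moreover have "is_component \<delta> \<beta>" unfolding \<delta>_def using fa by (rule is_component_comp_of)
  moreover have "rank \<gamma> t \<le> rank \<delta> (f t)"
    using wf wf' by (rule rank_mono_hom) (use hom_comp_of[OF f] in \<open>auto simp: a(2) \<delta>_def\<close>)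
  moreover have "root \<gamma> = t" "root \<delta> = f t"
    unfolding a(2) \<delta>_def using root_comp_of[OF a(1) t] root_comp_of[OF fa ft] .
  ultimately show ?thesis by auto
qed

text \<open>Each kind of component of \<alpha> draws on its own hypotheses. By contraposition,
  \<open>biorbits\<close> and \<open>left\<close> also make a component of \<alpha> well founded
  when ranks have to be compared.\<close>

lemma hom_exists:
  assumes cycles: "cycle_periods \<alpha> \<subseteq> cycle_periods \<beta>"
    and biorbits: "(\<exists>y. biorbit \<alpha> y) \<Longrightarrow> (\<exists>y. biorbit \<beta> y)"
    and rro: "\<And>\<gamma>. \<not> (\<exists>y. biorbit \<beta> y) \<Longrightarrow> is_component \<gamma> \<alpha> \<Longrightarrow> type_rro \<gamma> \<Longrightarrow>
      \<exists>\<delta>. is_component \<delta> \<beta> \<and> type_rro \<delta> \<and>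
        (\<exists>\<eta> x \<xi> y. is_right_ray x \<eta> \<and> maximal_in \<eta> \<gamma> \<and> is_right_ray y \<xi> \<and> maximal_in \<xi> \<delta> \<and>
          dominates (ray_rank \<delta> y) (ray_rank \<gamma> x))"
    and left: "has_maximal_left_ray \<alpha> \<Longrightarrow> has_maximal_left_ray \<beta>"
    and cho: "\<And>\<gamma>. \<not> has_maximal_left_ray \<beta> \<Longrightarrow> is_component \<gamma> \<alpha> \<Longrightarrow> type_cho \<gamma> \<Longrightarrow>
      \<exists>\<delta>. is_component \<delta> \<beta> \<and> type_cho \<delta> \<and> rank \<gamma> (root \<gamma>) \<le> rank \<delta> (root \<delta>)"
  shows "\<exists>f. pt_hom f \<alpha> \<beta>"
proof (rule glue_hom)
  fix a assume a: "a \<in> pspan \<alpha>"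
  \<comment> \<open>The constructions start from base points of their own, such as a point on the
    cycle or the terminal point, in the class of a.\<close>
  have shift: "\<exists>f. \<forall>z. conn \<alpha> a z \<longrightarrow> \<beta> (f z) = map_option f (\<alpha> z)"
    if "conn \<alpha> a b" "\<exists>f. \<forall>z. conn \<alpha> b z \<longrightarrow> \<beta> (f z) = map_option f (\<alpha> z)" for b
    using that by (meson conn_sym conn_trans)
  consider (cycle) c k where "conn \<alpha> a c" "k \<ge> 1" "pt_pow \<alpha> k c = Some c"
    | (terminal) t where "conn \<alpha> a t" "\<alpha> t = None"
    | (total) "\<And>c k. conn \<alpha> a c \<Longrightarrow> k \<ge> 1 \<Longrightarrow> pt_pow \<alpha> k c \<noteq> Some c" "\<And>t. conn \<alpha> a t \<Longrightarrow> \<alpha> t \<noteq> None"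
    by blast
  then show "\<exists>f. \<forall>z. conn \<alpha> a z \<longrightarrow> \<beta> (f z) = map_option f (\<alpha> z)"
  proof cases
    case cycle
    obtain l where l: "l \<ge> 1" "pt_pow \<alpha> l c = Some c"
      "\<And>j. 1 \<le> j \<Longrightarrow> j < l \<Longrightarrow> pt_pow \<alpha> j c \<noteq> Some c"
      using cycle_periods_minimal[OF cycle(2,3)] by metis
    then have "l \<in> cycle_periods \<beta>" using cycles unfolding cycle_periods_def by blast
    then obtain w where w: "pt_pow \<beta> l w = Some w" by (auto simp: cycle_periods_def)
    show ?thesis by (rule shift[OF cycle(1) hom_to_cycle[OF l(2,1,3) w]])
  next
    case terminal
    show ?thesis
    proof (cases "has_maximal_left_ray \<beta>")
      case True
      show ?thesis by (rule shift[OF terminal(1) hom_to_left_ray[of \<alpha> t \<beta>, OF terminal(2) True]])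
    next
      case False
      then have wf: "wf (pred_rel (comp_of \<alpha> a))"
        using left by (intro wf_comp_of_terminal[OF terminal]) blast
      then have "type_cho (comp_of \<alpha> a)" using type_cho_comp_of[OF a] terminal by blast
      moreover have "is_component (comp_of \<alpha> a) \<alpha>" using a by (rule is_component_comp_of)
      ultimately obtain \<delta> where \<delta>: "is_component \<delta> \<beta>" "type_cho \<delta>"
          "rank (comp_of \<alpha> a) (root (comp_of \<alpha> a)) \<le> rank \<delta> (root \<delta>)"
        using cho[OF False, of "comp_of \<alpha> a"] by blast
      obtain b where b: "b \<in> pspan \<beta>" "\<delta> = comp_of \<beta> b" by (rule is_componentE[OF \<delta>(1)])
      obtain u where u: "wf (pred_rel (comp_of \<beta> b))" "conn \<beta> b u" "\<beta> u = None"
        using \<delta>(2) type_cho_comp_of[OF b(1)] unfolding b(2) by blast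
      show ?thesis
      proof (rule shift[OF terminal(1) hom_by_root_rank[of _ _ _ u]])
        show "wf (pred_rel (comp_of \<alpha> t))" using wf comp_of_eq[OF terminal(1)] by simp
        show "wf (pred_rel (comp_of \<beta> u))" using u(1) comp_of_eq[OF u(2)] by simp
        show "rank (comp_of \<alpha> t) t \<le> rank (comp_of \<beta> u) u"
          using \<delta>(3) root_comp_of[OF a terminal] root_comp_of[OF b(1) u(2,3)]
            comp_of_eq[OF terminal(1)] comp_of_eq[OF u(2)] unfolding b(2) by simp
      qed (fact terminal u)+
    qed
  next
    case total
    show ?thesis
    proof (cases "\<exists>y. biorbit \<beta> y")
      case True
      then obtain y where "biorbit \<beta> y" by blast
      with total show ?thesis by (rule hom_to_biorbit)
    next
      case False
      then have wf: "wf (pred_rel (comp_of \<alpha> a))"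
        using biorbits by (intro wf_comp_of_nonterminal[OF total(2)]) blast+
      then have "type_rro (comp_of \<alpha> a)" using type_rro_comp_of[OF a] total(2) by blast
      moreover have "is_component (comp_of \<alpha> a) \<alpha>" using a by (rule is_component_comp_of)
      ultimately obtain \<delta> \<eta> x \<xi> y where \<delta>: "is_component \<delta> \<beta>" "type_rro \<delta>"
        and x: "is_right_ray x \<eta>" "maximal_in \<eta> (comp_of \<alpha> a)"
        and y: "is_right_ray y \<xi>" "maximal_in \<xi> \<delta>"
        and dom: "dominates (ray_rank \<delta> y) (ray_rank (comp_of \<alpha> a) x)"
        using rro[OF False, of "comp_of \<alpha> a"] by blast
      obtain b where b: "b \<in> pspan \<beta>" "\<delta> = comp_of \<beta> b" by (rule is_componentE[OF \<delta>(1)])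
      have wf': "wf (pred_rel (comp_of \<beta> b))" using \<delta>(2) type_rro_iff[of \<delta>] b(2) by simp
      show ?thesis
        using wf wf' ray_contained[OF x] ray_contained[OF y] dom unfolding b(2)
        by (rule hom_by_ray_rank)
    qed
  qed
qed

theorem theorem5p3:
  fixes \<alpha> \<beta> :: "'a \<rightharpoonup> 'a"
  shows "conj_c pt_mul \<alpha> \<beta> \<longleftrightarrow>
    (\<alpha> = Map.empty \<and> \<beta> = Map.empty) \<or>
    (\<alpha> \<noteq> Map.empty \<and> \<beta> \<noteq> Map.empty \<and>
     cs \<alpha> = cs \<beta> \<and>
     (has_double_ray \<alpha> \<and> \<not> has_cycle \<alpha> \<longleftrightarrow> has_double_ray \<beta> \<and> \<not> has_cycle \<beta>) \<and>
     (\<not> has_cycle \<alpha> \<and> \<not> has_double_ray \<alpha> \<longrightarrow>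
        (\<forall>\<gamma>. is_component \<gamma> \<alpha> \<and> type_rro \<gamma> \<longrightarrow>
           \<not> has_cycle \<beta> \<and> \<not> has_double_ray \<beta> \<and>
           (\<exists>\<delta>. is_component \<delta> \<beta> \<and> type_rro \<delta> \<and>
              (\<exists>\<eta> x \<xi> y. is_right_ray x \<eta> \<and> maximal_in \<eta> \<gamma> \<and>
                 is_right_ray y \<xi> \<and> maximal_in \<xi> \<delta> \<and>
                 dominates (ray_rank \<delta> y) (ray_rank \<gamma> x))))) \<and>
     (\<not> has_cycle \<beta> \<and> \<not> has_double_ray \<beta> \<longrightarrow>
        (\<forall>\<delta>. is_component \<delta> \<beta> \<and> type_rro \<delta> \<longrightarrow>
           \<not> has_cycle \<alpha> \<and> \<not> has_double_ray \<alpha> \<and>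
           (\<exists>\<gamma>. is_component \<gamma> \<alpha> \<and> type_rro \<gamma> \<and>
              (\<exists>\<xi> y \<eta> x. is_right_ray y \<xi> \<and> maximal_in \<xi> \<delta> \<and>
                 is_right_ray x \<eta> \<and> maximal_in \<eta> \<gamma> \<and>
                 dominates (ray_rank \<gamma> x) (ray_rank \<delta> y))))) \<and>
     (has_maximal_left_ray \<alpha> \<longleftrightarrow> has_maximal_left_ray \<beta>) \<and>
     (\<not> has_maximal_left_ray \<alpha> \<longrightarrow>
        (\<forall>\<gamma>. is_component \<gamma> \<alpha> \<and> type_cho \<gamma> \<longrightarrow>
           \<not> has_maximal_left_ray \<beta> \<and>
           (\<exists>\<delta>. is_component \<delta> \<beta> \<and> type_cho \<delta> \<and>
              rank \<gamma> (root \<gamma>) \<le> rank \<delta> (root \<delta>)))) \<and>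
     (\<not> has_maximal_left_ray \<beta> \<longrightarrow>
        (\<forall>\<delta>. is_component \<delta> \<beta> \<and> type_cho \<delta> \<longrightarrow>
           \<not> has_maximal_left_ray \<alpha> \<and>
           (\<exists>\<gamma>. is_component \<gamma> \<alpha> \<and> type_cho \<gamma> \<and>
              rank \<delta> (root \<delta>) \<le> rank \<gamma> (root \<gamma>)))))"
    (is "_ \<longleftrightarrow> ?zero \<or> \<alpha> \<noteq> Map.empty \<and> \<beta> \<noteq> Map.empty \<and> ?C")
proof -
  have no_biorbit: "\<not> (\<exists>y. biorbit a y) \<longleftrightarrow> \<not> has_cycle a \<and> \<not> has_double_ray a" for a :: "'a \<rightharpoonup> 'a"
    using biorbit_iff by blast
  have "(\<exists>f. pt_hom f \<alpha> \<beta>) \<and> (\<exists>f. pt_hom f \<beta> \<alpha>) \<longleftrightarrow> ?C"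
  proof
    assume "(\<exists>f. pt_hom f \<alpha> \<beta>) \<and> (\<exists>f. pt_hom f \<beta> \<alpha>)"
    then obtain f g where f: "pt_hom f \<alpha> \<beta>" and g: "pt_hom g \<beta> \<alpha>" by blast
    have periods: "cycle_periods \<alpha> = cycle_periods \<beta>"
      using hom_cycle_periods[OF f] hom_cycle_periods[OF g] by blast
    then have cyc: "has_cycle \<alpha> \<longleftrightarrow> has_cycle \<beta>" by (simp add: has_cycle_iff)
    have "(\<exists>y. biorbit \<alpha> y) \<longleftrightarrow> (\<exists>y. biorbit \<beta> y)"
      using hom_biorbit[OF f] hom_biorbit[OF g] by blast
    \<comment> \<open>With cycles excluded, a bi-infinite orbit can only come from a double
      ray.\<close>
    then have ray: "has_double_ray \<alpha> \<longleftrightarrow> has_double_ray \<beta>" if "\<not> has_cycle \<alpha>"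
      using that cyc biorbit_iff by blast
    have left: "has_maximal_left_ray \<alpha> \<longleftrightarrow> has_maximal_left_ray \<beta>"
      using hom_maximal_left_ray[OF f] hom_maximal_left_ray[OF g] by blast
    show ?C
    proof (intro conjI impI allI; (elim conjE)?)
      show "cs \<alpha> = cs \<beta>" using periods by (simp add: cs_eq_iff)
    next
      show "has_double_ray \<alpha> \<and> \<not> has_cycle \<alpha> \<longleftrightarrow> has_double_ray \<beta> \<and> \<not> has_cycle \<beta>"
        using cyc ray by blast
    \<comment> \<open>In the remaining conditions the clauses about the other map follow from
      \<open>cyc\<close>, \<open>ray\<close> and \<open>left\<close>, and the matching components
      come from the homomorphisms.\<close>
    qed (simp_all only: cyc ray left hom_cho[OF f] hom_cho[OF g] hom_rro[OF f] hom_rro[OF g]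
          no_biorbit simp_thms not_False_eq_True)
  next
    assume C: ?C
    note C2 = C[THEN conjunct2, THEN conjunct1]
      and C3a = C[THEN conjunct2, THEN conjunct2, THEN conjunct1, rule_format]
      and C' = C[THEN conjunct2, THEN conjunct2, THEN conjunct2]
    note C3b = C'[THEN conjunct1, rule_format]
      and C4 = C'[THEN conjunct2, THEN conjunct1]
      and C5a = C'[THEN conjunct2, THEN conjunct2, THEN conjunct1, rule_format]
      and C5b = C'[THEN conjunct2, THEN conjunct2, THEN conjunct2, rule_format]
    have periods: "cycle_periods \<alpha> = cycle_periods \<beta>"
      using C[THEN conjunct1] by (simp add: cs_eq_iff)
    then have cyc: "has_cycle \<alpha> \<longleftrightarrow> has_cycle \<beta>" by (simp add: has_cycle_iff)
    \<comment> \<open>Condition (1) makes the presence of cycles agree; without cycles, condition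
      (2) makes the presence of double rays agree.\<close>
    have bio: "(\<exists>y. biorbit \<alpha> y) \<longleftrightarrow> (\<exists>y. biorbit \<beta> y)"
      using cyc C2 biorbit_iff by blast
    show "(\<exists>f. pt_hom f \<alpha> \<beta>) \<and> (\<exists>f. pt_hom f \<beta> \<alpha>)"
    proof (intro conjI hom_exists)
      fix \<gamma> assume "\<not> (\<exists>y. biorbit \<beta> y)" "is_component \<gamma> \<alpha>" "type_rro \<gamma>"
      then show "\<exists>\<delta>. is_component \<delta> \<beta> \<and> type_rro \<delta> \<and>
          (\<exists>\<eta> x \<xi> y. is_right_ray x \<eta> \<and> maximal_in \<eta> \<gamma> \<and> is_right_ray y \<xi> \<and> maximal_in \<xi> \<delta> \<and>
            dominates (ray_rank \<delta> y) (ray_rank \<gamma> x))"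
        using bio no_biorbit[of \<alpha>] by (intro C3a[THEN conjunct2, THEN conjunct2]) blast+
    next
      fix \<gamma> assume "\<not> (\<exists>y. biorbit \<alpha> y)" "is_component \<gamma> \<beta>" "type_rro \<gamma>"
      then show "\<exists>\<delta>. is_component \<delta> \<alpha> \<and> type_rro \<delta> \<and>
          (\<exists>\<eta> x \<xi> y. is_right_ray x \<eta> \<and> maximal_in \<eta> \<gamma> \<and> is_right_ray y \<xi> \<and> maximal_in \<xi> \<delta> \<and>
            dominates (ray_rank \<delta> y) (ray_rank \<gamma> x))"
        using bio no_biorbit[of \<beta>] by (intro C3b[THEN conjunct2, THEN conjunct2]) blast+
    next
      fix \<gamma> assume "\<not> has_maximal_left_ray \<beta>" "is_component \<gamma> \<alpha>" "type_cho \<gamma>"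
      then show "\<exists>\<delta>. is_component \<delta> \<beta> \<and> type_cho \<delta> \<and> rank \<gamma> (root \<gamma>) \<le> rank \<delta> (root \<delta>)"
        using C4 by (intro C5a[THEN conjunct2]) blast+
    next
      fix \<gamma> assume "\<not> has_maximal_left_ray \<alpha>" "is_component \<gamma> \<beta>" "type_cho \<gamma>"
      then show "\<exists>\<delta>. is_component \<delta> \<alpha> \<and> type_cho \<delta> \<and> rank \<gamma> (root \<gamma>) \<le> rank \<delta> (root \<delta>)"
        using C4 by (intro C5b[THEN conjunct2]) blast+
    qed (use periods bio C4 in \<open>simp_all only: order.refl\<close>)
  qed
  then show ?thesis unfolding conj_c_pt_mul_iff by simp
qed

end
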